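(* Let $p=2$, let $E$ be a finite extension of $\mathbb{Q}_2$ and let $D\subset\mathbb{C}_2$ be a disk (open or closed) defined over $E$. Let $e$ be the smallest integer such that there exists a finite extension $F$ of $E$ with ramification index $e_{F/E}=e$ and $F\cap D\neq\emptyset$. Then $e=2^s$ for some integer $s\geq 0$, and there exists a totally ramified extension $F$ of $E$ with $[F:E]=2^s$ such that $F\cap D\neq\emptyset$.
   Context: A disk in $\mathbb{C}_p$ is a set $\{x\in\mathbb{C}_p : |x-a|\leq r\}$ (closed) or $\{x\in\mathbb{C}_p: |x-a|<r\}$ (open) for some $a\in\mathbb{C}_p$ and real $r>0$. Finite extensions are taken inside $\bar{\mathbb{Q}}_p\subset\mathbb{C}_p$. The group $G_E=\operatorname{Gal}(\bar{\mathbb{Q}}_p/E)$ acts continuously on $\mathbb{C}_p$; $D$ is defined over $E$ if $\sigma(D)=D$ for all $\sigma\in G_E$. *)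

theory Defs
  imports "HOL-Analysis.Analysis" "HOL-Algebra.Algebraic_Closure_Type" "HOL-Algebra.Coset"
begin

text \<open>
  The field \<open>\<complex>\<^sub>p\<close> is a type \<open>'a\<close> that is at once a field and a complete metric space; its absolute
  value is the distance to \<open>0\<close>. Inside it, \<open>\<rat>\<^sub>p\<close> is the topological closure of the rationals, and
  \<open>Qp_bar\<close> is the set of elements that are algebraic over \<open>\<rat>\<^sub>p\<close>. The locale \<open>padic_complex_field\<close>
  below says that \<open>'a\<close> is the completion of an algebraic closure of \<open>\<rat>\<^sub>p\<close>, which determines it
  up to isometric isomorphism.
\<close>

definition absv :: "'a::{zero, metric_space} \<Rightarrow> real"
  where "absv x = dist x 0"

abbreviation Cp_ring :: "'a::field ring"
  where "Cp_ring \<equiv> ring_of_type_algebra"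

definition Qp :: "'a::{field_char_0, metric_space} set"
  where "Qp = closure \<rat>"

definition Qp_bar :: "'a::{field_char_0, metric_space} set"
  where "Qp_bar = {x. (ring.algebraic Cp_ring over Qp) x}"

abbreviation Qp_bar_ring :: "'a::{field_char_0, metric_space} ring"
  where "Qp_bar_ring \<equiv> Cp_ring\<lparr>carrier := Qp_bar\<rparr>"

text \<open>
  By multiplicativity, \<open>absv_of_nat\<close> makes the absolute value restrict to the \<open>p\<close>-adic one on \<open>\<rat>\<close>,
  normalised by \<open>\<bar>p\<bar> = 1/p\<close>.
\<close>

locale padic_complex_field =
  fixes p :: nat
  assumes prime_p: "Factorial_Ring.prime p"
    and dist_eq_absv: "\<And>x y :: 'a::{field_char_0, complete_space}. dist x y = absv (x - y)"
    and absv_mult: "\<And>x y :: 'a. absv (x * y) = absv x * absv y"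
    and absv_add_le: "\<And>x y :: 'a. absv (x + y) \<le> max (absv x) (absv y)"
    and absv_of_nat: "\<And>n. n > 0 \<Longrightarrow> absv (of_nat n :: 'a) = 1 / real p ^ multiplicity p n"
    and Qp_bar_alg_closure: "algebraic_closure (Qp_bar_ring :: 'a ring) Qp"
    and Qp_bar_dense: "closure Qp_bar = (UNIV :: 'a set)"

definition disk :: "'a::metric_space set \<Rightarrow> bool"
  where "disk D \<longleftrightarrow> (\<exists>a r. r > 0 \<and> (D = cball a r \<or> D = ball a r))"

definition finite_field_ext :: "'a::{field_char_0, metric_space} set \<Rightarrow> 'a set \<Rightarrow> bool"
  where "finite_field_ext K L \<longleftrightarrow>
    subfield K Cp_ring \<and> subfield L Cp_ring \<and> K \<subseteq> L \<and> L \<subseteq> Qp_bar \<and>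
    ring.finite_dimension Cp_ring K L"

abbreviation ext_degree :: "'a::field set \<Rightarrow> 'a set \<Rightarrow> nat"
  where "ext_degree K L \<equiv> ring.dim Cp_ring K L"

definition value_group :: "'a::{field, metric_space} set \<Rightarrow> real monoid"
  where "value_group K = \<lparr>carrier = absv ` (K - {0}), monoid.mult = (*), one = 1\<rparr>"

text \<open>The ramification index of \<open>L/K\<close> is the index of \<open>\<bar>K\<^sup>\<times>\<bar>\<close> in \<open>\<bar>L\<^sup>\<times>\<bar>\<close>.\<close>

definition ramification_index :: "'a::{field, metric_space} set \<Rightarrow> 'a set \<Rightarrow> nat"
  where "ramification_index K L = card (rcosets\<^bsub>value_group L\<^esub> (carrier (value_group K)))"

definition totally_ramified :: "'a::{field, metric_space} set \<Rightarrow> 'a set \<Rightarrow> bool"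
  where "totally_ramified K L \<longleftrightarrow> ramification_index K L = ext_degree K L"

text \<open>
  An element of \<open>Gal E\<close> matters only through its values on \<open>Qp_bar\<close>; \<open>gal_act\<close> is its unique
  continuous extension to \<open>\<complex>\<^sub>p\<close>.
\<close>

definition Gal :: "'a::{field_char_0, metric_space} set \<Rightarrow> ('a \<Rightarrow> 'a) set"
  where "Gal E = {\<sigma> \<in> ring_iso Qp_bar_ring Qp_bar_ring. \<forall>x\<in>E. \<sigma> x = x}"

definition gal_act :: "('a \<Rightarrow> 'a) \<Rightarrow> 'a::{field_char_0, metric_space} \<Rightarrow> 'a"
  where "gal_act \<sigma> = (THE \<tau>. continuous_on UNIV \<tau> \<and> (\<forall>x\<in>Qp_bar. \<tau> x = \<sigma> x))"

definition defined_over :: "'a::{field_char_0, metric_space} set \<Rightarrow> 'a set \<Rightarrow> bool"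
  where "defined_over E D \<longleftrightarrow> (\<forall>\<sigma>\<in>Gal E. gal_act \<sigma> ` D = D)"

end

theory Submission
  imports Defs "HOL-Algebra.Exponent"
begin

text \<open>
  Let \<open>n\<close> be the least degree of a nonzero polynomial over \<open>E\<close> that has a root in \<open>D\<close>, so that
  polynomials over \<open>E\<close> of smaller degree have no root in \<open>D\<close>. A polynomial attaining \<open>n\<close> has all its roots
  in \<open>D\<close>, because the Galois group permutes them transitively. If the exact power \<open>q\<close> of \<open>p\<close>
  dividing \<open>n\<close> were smaller than \<open>n\<close>, its \<open>q\<close>-th derivative would also have a root in \<open>D\<close>,
  since the binomial coefficient \<open>n choose q\<close> is prime to \<open>p\<close>; hence \<open>n\<close> is a power of \<open>p\<close>.

  Let \<open>F\<close> be a finite extension of \<open>E\<close> that contains a point \<open>x\<close> of \<open>D\<close>, and let \<open>V\<close> be the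
  \<open>n\<close>-dimensional space of the values \<open>A x\<close> for polynomials \<open>A\<close> over \<open>E\<close> of degree less than \<open>n\<close>.
  As these have no root in \<open>D\<close>, a quotient \<open>A / B\<close> has constant residue on \<open>D\<close>, so
  the residue of a unit \<open>A x / B x\<close> is Galois invariant and lies in the residue field of \<open>E\<close>. Elements of
  \<open>V\<close> with values in distinct classes modulo the value group of \<open>E\<close> therefore span \<open>V\<close> as soon as every class
  occurring in \<open>V\<close> is represented, which gives \<open>n \<le> e(F/E)\<close>. Together with
  \<open>e(F/E) \<le> [F : E]\<close> this shows that the extension generated by a point of \<open>D\<close> of degree \<open>n\<close> is
  totally ramified and that \<open>n\<close> is the least ramification index.
\<close>

section \<open>Subfields, polynomials and spans\<close>

hide_const (open) Polynomials.degree Polynomials.lead_coeff up_ring.coeff up_ring.monom Module.smult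

lemma Cp_ring_simps [simp]:
  "carrier Cp_ring = (UNIV :: 'a::field set)"
  "monoid.mult Cp_ring = ((*) :: 'a \<Rightarrow> 'a \<Rightarrow> 'a)"
  "monoid.one Cp_ring = (1 :: 'a)"
  "ring.zero Cp_ring = (0 :: 'a)"
  "add Cp_ring = ((+) :: 'a \<Rightarrow> 'a \<Rightarrow> 'a)"
  by (simp_all add: ring_of_type_algebra_def)

interpretation Cp: domain "Cp_ring :: 'a::field ring"
  using field_from_type_algebra by (rule field.axioms)

lemma Cp_a_inv [simp]: "a_inv Cp_ring x = (- x :: 'a::field)"
  by (rule Cp.add.inv_equality[of "- x" x, simplified])

lemma Cp_m_inv [simp]: "x \<noteq> 0 \<Longrightarrow> m_inv Cp_ring x = inverse (x :: 'a::field)"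
  by (rule Cp.comm_inv_char) simp_all

lemma subfield_Cp_closed:
  assumes "subfield K (Cp_ring :: 'a::field ring)"
  shows "0 \<in> K" "1 \<in> K"
    "\<And>x. x \<in> K \<Longrightarrow> - x \<in> K"
    "\<And>x y. x \<in> K \<Longrightarrow> y \<in> K \<Longrightarrow> x + y \<in> K"
    "\<And>x y. x \<in> K \<Longrightarrow> y \<in> K \<Longrightarrow> x - y \<in> K"
    "\<And>x y. x \<in> K \<Longrightarrow> y \<in> K \<Longrightarrow> x * y \<in> K"
    "\<And>x. x \<in> K \<Longrightarrow> inverse x \<in> K"
    "\<And>x y. x \<in> K \<Longrightarrow> y \<in> K \<Longrightarrow> x / y \<in> K"
    "\<And>x m. x \<in> K \<Longrightarrow> x ^ m \<in> K"
    "\<And>m. of_nat m \<in> K"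
proof -
  note E = subringE[OF subfieldE(1)[OF assms], simplified]
  show 0: "0 \<in> K" and 1: "1 \<in> K" by (fact E)+
  show u: "- x \<in> K" if "x \<in> K" for x by (simp add: E that)
  show p: "x + y \<in> K" if "x \<in> K" "y \<in> K" for x y by (simp add: E that)
  show m: "x * y \<in> K" if "x \<in> K" "y \<in> K" for x y by (simp add: E that)
  show "x - y \<in> K" if "x \<in> K" "y \<in> K" for x y using p[OF that(1) u[OF that(2)]] by simp
  show i: "inverse x \<in> K" if "x \<in> K" for x
    using Cp.subfield_m_inv(1)[OF assms, of x] that 0 by (cases "x = 0") auto
  show "x / y \<in> K" if "x \<in> K" "y \<in> K" for x y
    using m[OF that(1) i[OF that(2)]] by (simp add: divide_inverse)
  show "x ^ m \<in> K" if "x \<in> K" for x m by (induction m) (auto simp: 1 m that)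
  show "of_nat m \<in> K" for m by (induction m) (auto simp: 0 1 p)
qed

section \<open>Polynomials with coefficients in a subfield\<close>

definition poly_over :: "'a::zero set \<Rightarrow> 'a poly \<Rightarrow> bool"
  where "poly_over K P \<longleftrightarrow> (\<forall>i. coeff P i \<in> K)"

lemma poly_over_pCons: "poly_over K (pCons a P) \<longleftrightarrow> a \<in> K \<and> poly_over K P"
  unfolding poly_over_def
  by (metis coeff_pCons_0 coeff_pCons_Suc not0_implies_Suc)

lemma poly_over_0: "0 \<in> K \<Longrightarrow> poly_over K 0"
  by (simp add: poly_over_def)

lemma poly_over_mono: "K \<subseteq> L \<Longrightarrow> poly_over K P \<Longrightarrow> poly_over L P"
  by (auto simp: poly_over_def)

lemma poly_over_ops:
  assumes "subfield K (Cp_ring :: 'a::field ring)"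
  shows "poly_over K P \<Longrightarrow> poly_over K Q \<Longrightarrow> poly_over K (P + Q)"
    and "poly_over K P \<Longrightarrow> poly_over K Q \<Longrightarrow> poly_over K (P - Q)"
    and "poly_over K P \<Longrightarrow> c \<in> K \<Longrightarrow> poly_over K (smult c P)"
  by (auto simp: poly_over_def subfield_Cp_closed[OF assms])

lemma poly_over_poly:
  assumes "subfield K (Cp_ring :: 'a::field ring)" "poly_over K P" "x \<in> K"
  shows "poly P x \<in> K"
  using assms(2)
  by (induction P) (auto simp: poly_over_pCons subfield_Cp_closed[OF assms(1)] assms(3))

text \<open>\<open>ring.eval\<close> reads a coefficient list from the leading coefficient down,
  \<open>Poly\<close> from the constant term up; \<open>rev\<close> translates between the
  two.\<close>

lemma eval_Cp: "ring.eval Cp_ring q x = poly (Poly (rev q)) (x :: 'a::field)"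
proof -
  have pow: "x [^]\<^bsub>Cp_ring\<^esub> (n::nat) = x ^ n" for n
    by (induction n) auto
  show ?thesis by (induction q) (auto simp: Poly_append poly_monom pow)
qed

lemma Cp_univ_poly_iff:
  assumes "subfield K (Cp_ring :: 'a::field ring)"
  shows "q \<in> carrier (univ_poly Cp_ring K) \<longleftrightarrow> set q \<subseteq> K \<and> (q = [] \<or> hd q \<noteq> 0)"
  by (auto simp: univ_poly_def polynomial_def)

lemma Cp_list_of_poly:
  assumes "subfield K (Cp_ring :: 'a::field ring)" "poly_over K P"
  shows "rev (coeffs P) \<in> carrier (univ_poly Cp_ring K)"
  using assms(2) unfolding Cp_univ_poly_iff[OF assms(1)]
  by (auto simp: poly_over_def coeffs_def hd_rev last_map split: if_splits)

lemma algebraic_Cp_iff: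
  assumes "subfield K (Cp_ring :: 'a::field ring)"
  shows "(ring.algebraic Cp_ring over K) x \<longleftrightarrow> (\<exists>P. poly_over K P \<and> P \<noteq> 0 \<and> poly P x = 0)"
proof
  assume "(ring.algebraic Cp_ring over K) x"
  then obtain q where q: "q \<in> carrier (univ_poly Cp_ring K)" "q \<noteq> []" "ring.eval Cp_ring q x = 0"
    using Cp.algebraicE[OF subfieldE(1)[OF assms], of x] by auto
  have "set q \<subseteq> K" "hd q \<noteq> 0" using q(1,2) by (auto simp: Cp_univ_poly_iff[OF assms])
  have *: "hd q = coeff (Poly (rev q)) (length q - 1)"
    using q(2) by (cases q) (auto simp: nth_default_def nth_append)
  have "poly_over K (Poly (rev q))"
    using \<open>set q \<subseteq> K\<close> subfield_Cp_closed(1)[OF assms]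
    by (auto simp: poly_over_def nth_default_def) (metis in_mono length_rev nth_mem set_rev)
  moreover have "Poly (rev q) \<noteq> 0"
    using \<open>hd q \<noteq> 0\<close> * by (metis coeff_0)
  ultimately show "\<exists>P. poly_over K P \<and> P \<noteq> 0 \<and> poly P x = 0"
    using q(3) unfolding eval_Cp by blast
next
  assume "\<exists>P. poly_over K P \<and> P \<noteq> 0 \<and> poly P x = 0"
  then obtain P where P: "poly_over K P" "P \<noteq> 0" "poly P x = 0" by blast
  show "(ring.algebraic Cp_ring over K) x"
    using Cp.algebraicI[OF Cp_list_of_poly[OF assms P(1)], of x] P by (auto simp: eval_Cp)
qed

lemma degree_prod_list_linear: "degree (\<Prod>r\<leftarrow>rs. [:- r, 1 :: 'a::field:]) = length rs"
proof (induction rs)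
  case (Cons r rs)
  have "(\<Prod>r\<leftarrow>rs. [:- r, 1 :: 'a:]) \<noteq> 0" by (auto simp: prod_list_zero_iff)
  then show ?case using Cons by (simp add: degree_mult_eq del: mult_pCons_left)
qed simp

lemma poly_prod_list_linear: "poly (\<Prod>r\<leftarrow>rs. [:- r, 1 :: 'a::field:]) x = (\<Prod>r\<leftarrow>rs. x - r)"
  by (induction rs) (simp_all add: algebra_simps)

section \<open>Linear spans over a subfield\<close>

lemma Span_Cp_Nil [simp]: "ring.Span (Cp_ring :: 'a::field ring) K [] = {0}"
  by simp

lemma Span_Cp_Cons:
  "x \<in> ring.Span (Cp_ring :: 'a::field ring) K (u # Us) \<longleftrightarrow>
     (\<exists>c\<in>K. \<exists>v\<in>ring.Span Cp_ring K Us. x = c * u + v)"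
  by (simp add: Cp.line_extension_mem_iff)

declare Cp.Span.simps [simp del]

lemma Span_Cp_closed:
  assumes "subfield K (Cp_ring :: 'a::field ring)"
  shows "0 \<in> ring.Span Cp_ring K Us"
    "x \<in> ring.Span Cp_ring K Us \<Longrightarrow> y \<in> ring.Span Cp_ring K Us \<Longrightarrow> x + y \<in> ring.Span Cp_ring K Us"
    "x \<in> ring.Span Cp_ring K Us \<Longrightarrow> y \<in> ring.Span Cp_ring K Us \<Longrightarrow> x - y \<in> ring.Span Cp_ring K Us"
    "c \<in> K \<Longrightarrow> x \<in> ring.Span Cp_ring K Us \<Longrightarrow> c * x \<in> ring.Span Cp_ring K Us"
    "set Us \<subseteq> ring.Span Cp_ring K Us"
proof -
  note P = Cp.Span_subgroup_props[OF assms, of Us]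
  show 0: "0 \<in> ring.Span Cp_ring K Us" using P(2) by simp
  show add: "x + y \<in> ring.Span Cp_ring K Us"
    if "x \<in> ring.Span Cp_ring K Us" "y \<in> ring.Span Cp_ring K Us" for x y
    using P(3)[of x y] that by simp
  show "x - y \<in> ring.Span Cp_ring K Us"
    if "x \<in> ring.Span Cp_ring K Us" "y \<in> ring.Span Cp_ring K Us"
    using add[of x "- y"] P(4)[of y] that by simp
  show "c * x \<in> ring.Span Cp_ring K Us" if "c \<in> K" "x \<in> ring.Span Cp_ring K Us"
    using Cp.Span_smult_closed[OF assms, of Us c x] that by simp
  show "set Us \<subseteq> ring.Span Cp_ring K Us"
    using Cp.Span_base_incl[OF assms, of Us] by simp
qed

lemma Span_Cp_subset:
  assumes "subfield L (Cp_ring :: 'a::field ring)" "K \<subseteq> L" "set Us \<subseteq> L"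
  shows "ring.Span Cp_ring K Us \<subseteq> L"
  using assms(3)
proof (induction Us)
  case Nil
  then show ?case using subfield_Cp_closed(1)[OF assms(1)] by simp
next
  case (Cons u Us)
  show ?case
  proof
    fix x assume "x \<in> ring.Span Cp_ring K (u # Us)"
    then obtain c v where "c \<in> K" "v \<in> ring.Span Cp_ring K Us" "x = c * u + v"
      unfolding Span_Cp_Cons by blast
    then show "x \<in> L"
      using Cons assms(2) by (auto intro!: subfield_Cp_closed(4,6)[OF assms(1)])
  qed
qed

section \<open>Extending embeddings to an algebraic closure\<close>

text \<open>Purely algebraic setting for conjugation, instantiated below with \<open>Qp_bar\<close>
  for \<open>A\<close>.\<close>

locale relative_algebraic_closure =
  fixes E A :: "'a::field set"
  assumes sub_E: "subfield E Cp_ring" and sub_A: "subfield A Cp_ring" and E_A: "E \<subseteq> A"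
    and alg: "\<And>x. x \<in> A \<Longrightarrow> \<exists>P. poly_over E P \<and> P \<noteq> 0 \<and> poly P x = 0"
    and root: "\<And>P. poly_over A P \<Longrightarrow> degree P > 0 \<Longrightarrow> \<exists>x\<in>A. poly P x = 0"
begin

lemmas E_closed = subfield_Cp_closed[OF sub_E]
lemmas A_closed = subfield_Cp_closed[OF sub_A]

text \<open>Partial embeddings over \<open>E\<close> are represented by their graphs, which are the subrings of
  \<open>A \<times> A\<close> that contain the diagonal of \<open>E\<close> and are single-valued at \<open>0\<close>; domains are then
  automatically fields, because \<open>A\<close> is algebraic over \<open>E\<close>.\<close>

definition embedding_graph :: "('a \<times> 'a) set \<Rightarrow> bool"
  where "embedding_graph \<Gamma> \<longleftrightarrow> \<Gamma> \<subseteq> A \<times> A \<and> (\<forall>c\<in>E. (c, c) \<in> \<Gamma>) \<and>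
    (\<forall>x y x' y'. (x, y) \<in> \<Gamma> \<longrightarrow> (x', y') \<in> \<Gamma> \<longrightarrow> (x + x', y + y') \<in> \<Gamma> \<and> (x * x', y * y') \<in> \<Gamma>) \<and>
    (\<forall>w. (0, w) \<in> \<Gamma> \<longrightarrow> w = 0)"

lemma embedding_graph_D:
  assumes "embedding_graph \<Gamma>"
  shows "(x, y) \<in> \<Gamma> \<Longrightarrow> x \<in> A" "(x, y) \<in> \<Gamma> \<Longrightarrow> y \<in> A"
    "c \<in> E \<Longrightarrow> (c, c) \<in> \<Gamma>"
    "(x, y) \<in> \<Gamma> \<Longrightarrow> (x', y') \<in> \<Gamma> \<Longrightarrow> (x + x', y + y') \<in> \<Gamma>"
    "(x, y) \<in> \<Gamma> \<Longrightarrow> (x', y') \<in> \<Gamma> \<Longrightarrow> (x * x', y * y') \<in> \<Gamma>"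
    "(0, w) \<in> \<Gamma> \<Longrightarrow> w = 0"
proof -
  note * = assms[unfolded embedding_graph_def]
  note 1 = conjunct1[OF *] note 2 = conjunct1[OF conjunct2[OF *]]
  note 3 = conjunct1[OF conjunct2[OF conjunct2[OF *]]]
  note 4 = conjunct2[OF conjunct2[OF conjunct2[OF *]]]
  show "x \<in> A" "y \<in> A" if "(x, y) \<in> \<Gamma>" using that 1 by blast+
  show "(c, c) \<in> \<Gamma>" if "c \<in> E" using that 2 by blast
  show "(x + x', y + y') \<in> \<Gamma>" "(x * x', y * y') \<in> \<Gamma>" if "(x, y) \<in> \<Gamma>" "(x', y') \<in> \<Gamma>"
    using that 3 by blast+
  show "w = 0" if "(0, w) \<in> \<Gamma>" using that 4 by blast
qed

lemma embedding_graph_minus: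
  assumes "embedding_graph \<Gamma>" "(x, y) \<in> \<Gamma>" "(x', y') \<in> \<Gamma>"
  shows "(x - x', y - y') \<in> \<Gamma>"
proof -
  have "(-1, -1) \<in> \<Gamma>"
    by (intro embedding_graph_D(3)[OF assms(1)] E_closed(2,3))
  from embedding_graph_D(5)[OF assms(1) this assms(3)] have "(- x', - y') \<in> \<Gamma>" by simp
  from embedding_graph_D(4)[OF assms(1) assms(2) this] show ?thesis by simp
qed

lemma embedding_graph_unique:
  assumes "embedding_graph \<Gamma>" "(x, y) \<in> \<Gamma>" "(x, y') \<in> \<Gamma>"
  shows "y = y'"
  using embedding_graph_minus[OF assms] embedding_graph_D(6)[OF assms(1), of "y - y'"] by simp

lemma embedding_graph_sum:
  assumes "embedding_graph \<Gamma>" "\<And>i. i \<in> I \<Longrightarrow> (f i, g i) \<in> \<Gamma>"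
  shows "(sum f I, sum g I) \<in> \<Gamma>"
  using assms(2)
proof (induction I rule: infinite_finite_induct)
  case (insert i I)
  then show ?case using embedding_graph_D(4)[OF assms(1)] by simp
qed (simp_all add: embedding_graph_D(3)[OF assms(1) E_closed(1)])

lemma embedding_graph_poly:
  assumes "embedding_graph \<Gamma>" "(x, y) \<in> \<Gamma>" "poly_over E P"
  shows "(poly P x, poly P y) \<in> \<Gamma>"
  using assms(3)
proof (induction P)
  case 0
  then show ?case using embedding_graph_D(3)[OF assms(1) E_closed(1)] by simp
next
  case (pCons a P)
  then show ?case
    by (simp add: poly_over_pCons embedding_graph_D(3-5)[OF assms(1)] assms(2))
qed

text \<open>Cancelling the factor \<open>x\<close> as long as the constant coefficient vanishes
  leaves a relation with nonzero constant term \<open>c\<close>, which exhibits the inverse of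
  \<open>x\<close> as a polynomial in \<open>x\<close>.\<close>

lemma nonzero_root_imp_nonzero_coeff_0:
  assumes "x \<noteq> 0" "poly_over E P" "P \<noteq> 0" "poly P x = 0"
  shows "\<exists>c Q. c \<in> E \<and> c \<noteq> 0 \<and> poly_over E Q \<and> c + x * poly Q x = 0"
  using assms(2-4)
proof (induction P)
  case (pCons a P)
  show ?case
  proof (cases "a = 0")
    case True
    then have "poly_over E P" "P \<noteq> 0" "poly P x = 0"
      using pCons.prems assms(1) by (simp_all add: poly_over_pCons)
    then show ?thesis by (rule pCons.IH)
  next
    case False
    then have "a \<in> E \<and> a \<noteq> 0 \<and> poly_over E P \<and> a + x * poly P x = 0"
      using pCons.prems by (simp add: poly_over_pCons)
    then show ?thesis by blast
  qed
qed simp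

text \<open>The inverse of \<open>x\<close> is \<open>- 1 / c\<close> times the value at
  \<open>x\<close> of a polynomial over \<open>E\<close>, and \<open>y\<close> inherits the relation
  behind this, so closure under sums and products suffices.\<close>

lemma embedding_graph_inverse:
  assumes \<Gamma>: "embedding_graph \<Gamma>" and xy: "(x, y) \<in> \<Gamma>"
  shows "(inverse x, inverse y) \<in> \<Gamma>"
proof (cases "x = 0")
  case True
  then have "y = 0" using xy embedding_graph_D(6)[OF \<Gamma>] by blast
  then show ?thesis using xy True by simp
next
  case False
  obtain c Q where cQ: "c \<in> E" "c \<noteq> 0" "poly_over E Q" "c + x * poly Q x = 0"
    using nonzero_root_imp_nonzero_coeff_0[OF False] alg[OF embedding_graph_D(1)[OF \<Gamma> xy]] by blast
  note QQ = embedding_graph_poly[OF \<Gamma> xy cQ(3)]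
  have "(c + x * poly Q x, c + y * poly Q y) \<in> \<Gamma>"
    by (intro embedding_graph_D(3-5)[OF \<Gamma>] QQ xy cQ(1))
  then have y: "c + y * poly Q y = 0" using cQ(4) embedding_graph_D(6)[OF \<Gamma>] by metis
  then have "y \<noteq> 0" using cQ(2) by auto
  have *: "inverse z = (- 1 / c) * poly Q z" if "z \<noteq> 0" "c + z * poly Q z = 0" for z
  proof -
    have "z * poly Q z = - c" using that(2) by (simp add: eq_neg_iff_add_eq_0 add.commute)
    then have "z * ((- 1 / c) * poly Q z) = 1" using cQ(2) by (simp add: field_simps)
    then show ?thesis by (rule inverse_unique)
  qed
  have "- 1 / c \<in> E" by (intro E_closed cQ(1))
  then have "((- 1 / c) * poly Q x, (- 1 / c) * poly Q y) \<in> \<Gamma>"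
    by (intro QQ embedding_graph_D(3,5)[OF \<Gamma>])
  then show ?thesis unfolding *[OF False cQ(4)] *[OF \<open>y \<noteq> 0\<close> y] .
qed

text \<open>If \<open>x\<close> were nonzero, multiplying by the pair of inverses would relate 1 to
  0, while \<open>E\<close> already relates 1 to 1.\<close>

lemma embedding_graph_injective:
  assumes "embedding_graph \<Gamma>" "(x, 0) \<in> \<Gamma>"
  shows "x = 0"
proof (rule ccontr)
  assume "x \<noteq> 0"
  have "(x * inverse x, 0 * inverse 0) \<in> \<Gamma>"
    using embedding_graph_D(5)[OF assms(1) assms(2) embedding_graph_inverse[OF assms]] .
  then have "(1, 0) \<in> \<Gamma>" using \<open>x \<noteq> 0\<close> by simp
  moreover have "(1, 1) \<in> \<Gamma>" by (intro embedding_graph_D(3)[OF assms(1)] E_closed(2))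
  ultimately have "(1::'a) = 0" using embedding_graph_unique[OF assms(1)] by metis
  then show False by simp
qed

text \<open>\<open>R\<close> is the image of \<open>P\<close> when the partial embedding acts on
  coefficients.\<close>

definition coeffwise :: "('a \<times> 'a) set \<Rightarrow> 'a poly \<Rightarrow> 'a poly \<Rightarrow> bool"
  where "coeffwise \<Gamma> P R \<longleftrightarrow> (\<forall>i. (coeff P i, coeff R i) \<in> \<Gamma>)"

lemma coeffwise_ops:
  assumes "embedding_graph \<Gamma>" "coeffwise \<Gamma> P R" "coeffwise \<Gamma> P' R'"
  shows "coeffwise \<Gamma> (P + P') (R + R')" "coeffwise \<Gamma> (P - P') (R - R')"
    "coeffwise \<Gamma> (P * P') (R * R')"
  using assms(2,3) unfolding coeffwise_def
  by (auto simp: coeff_mult intro!: embedding_graph_minus[OF assms(1)]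
    embedding_graph_D(4,5)[OF assms(1)] embedding_graph_sum[OF assms(1)])

lemma coeffwise_monom:
  assumes "embedding_graph \<Gamma>" "(c, d) \<in> \<Gamma>"
  shows "coeffwise \<Gamma> (monom c k) (monom d k)"
  using assms(2) embedding_graph_D(3)[OF assms(1) E_closed(1)] by (auto simp: coeffwise_def)

text \<open>Corresponding coefficients vanish together: single-valuedness at 0 gives one direction,
  injectivity the other.\<close>

lemma coeffwise_degree:
  assumes "embedding_graph \<Gamma>" "coeffwise \<Gamma> P R"
  shows "degree R = degree P"
proof -
  have "coeff R i = 0 \<longleftrightarrow> coeff P i = 0" for i
    using assms(2) embedding_graph_D(6)[OF assms(1)] embedding_graph_injective[OF assms(1)]
    unfolding coeffwise_def by metis
  then show ?thesis unfolding degree_def by simp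
qed

text \<open>Division with remainder by \<open>P\<^sub>0\<close>, carried out simultaneously on both sides of the graph.\<close>

lemma coeffwise_root:
  assumes \<Gamma>: "embedding_graph \<Gamma>" and rel0: "coeffwise \<Gamma> P0 R0" and "P0 \<noteq> 0"
    and x: "poly P0 x = 0" and y: "poly R0 y = 0"
    and minimal: "\<And>P R. coeffwise \<Gamma> P R \<Longrightarrow> P \<noteq> 0 \<Longrightarrow> poly P x = 0 \<Longrightarrow> degree P0 \<le> degree P"
    and rel: "coeffwise \<Gamma> P R" and Px: "poly P x = 0"
  shows "poly R y = 0"
  using rel Px
proof (induction "degree P" arbitrary: P R rule: less_induct)
  case less
  show ?case
  proof (cases "P = 0")
    case True
    then have "R = 0"
      using less.prems(1) embedding_graph_D(6)[OF \<Gamma>] by (auto simp: coeffwise_def poly_eq_iff)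
    then show ?thesis by simp
  next
    case False
    define c where "c = lead_coeff P / lead_coeff P0"
    define d where "d = coeff R (degree P) / coeff R0 (degree P0)"
    define k where "k = degree P - degree P0"
    have deg: "degree P0 \<le> degree P" using minimal less.prems False by blast
    \<comment> \<open>Positive degree of \<open>P0\<close> makes the drop in degree below strict
      even when \<open>P'\<close> is 0.\<close>
    have "degree P0 > 0"
      using \<open>P0 \<noteq> 0\<close> x by (metis degree_eq_zeroE neq0_conv poly_const_conv pCons_0_0)
    have "(c, d) \<in> \<Gamma>"
      using less.prems(1) rel0 unfolding c_def d_def coeffwise_def divide_inverse
      by (intro embedding_graph_D(5)[OF \<Gamma>] embedding_graph_inverse[OF \<Gamma>]) auto
    define P' where "P' = P - monom c k * P0"
    define R' where "R' = R - monom d k * R0"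
    have rel': "coeffwise \<Gamma> P' R'"
      unfolding P'_def R'_def
      by (intro coeffwise_ops[OF \<Gamma>] coeffwise_monom[OF \<Gamma>] less.prems(1) rel0 \<open>(c, d) \<in> \<Gamma>\<close>)
    have "degree (monom c k * P0) \<le> degree P"
      using degree_mult_le[of "monom c k" P0] degree_monom_le[of c k] deg
      unfolding k_def by linarith
    then have "degree P' \<le> degree P"
      unfolding P'_def by (intro degree_diff_le) auto
    moreover have "coeff P' (degree P) = 0"
      using deg \<open>P0 \<noteq> 0\<close> by (simp add: P'_def k_def c_def coeff_monom_mult)
    ultimately have "degree P' < degree P"
      using deg \<open>degree P0 > 0\<close>
      by (metis degree_0 leading_coeff_0_iff less_le_trans order_le_imp_less_or_eq)
    moreover have "poly P' x = 0" using less.prems(2) x by (simp add: P'_def)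
    ultimately have "poly R' y = 0" using less.hyps rel' by blast
    then show ?thesis using y by (simp add: R'_def)
  qed
qed

text \<open>The pair \<open>(x, y)\<close> is adjoined by taking the values at \<open>x\<close> and
  \<open>y\<close> of all related pairs of polynomials; division by the minimal relation
  \<open>P0\<close> keeps the result single-valued at 0.\<close>

lemma embedding_graph_extend:
  assumes \<Gamma>: "embedding_graph \<Gamma>" and rel0: "coeffwise \<Gamma> P0 R0" and "P0 \<noteq> 0"
    and x: "poly P0 x = 0" and y: "poly R0 y = 0" and A: "x \<in> A" "y \<in> A"
    and minimal: "\<And>P R. coeffwise \<Gamma> P R \<Longrightarrow> P \<noteq> 0 \<Longrightarrow> poly P x = 0 \<Longrightarrow> degree P0 \<le> degree P"
  shows "\<exists>\<Gamma>'. embedding_graph \<Gamma>' \<and> \<Gamma> \<subseteq> \<Gamma>' \<and> (x, y) \<in> \<Gamma>'"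
proof -
  define \<Gamma>' where "\<Gamma>' = {(poly P x, poly R y) | P R. coeffwise \<Gamma> P R}"
  have const: "coeffwise \<Gamma> [:c:] [:d:]" if "(c, d) \<in> \<Gamma>" for c d
    using coeffwise_monom[OF \<Gamma> that, of 0] by (simp add: monom_0)
  have sub: "\<Gamma> \<subseteq> \<Gamma>'"
  proof clarify
    fix c d assume "(c, d) \<in> \<Gamma>"
    from const[OF this] show "(c, d) \<in> \<Gamma>'" unfolding \<Gamma>'_def by force
  qed
  have "coeffwise \<Gamma> (monom 1 1) (monom 1 1)"
    by (intro coeffwise_monom[OF \<Gamma>] embedding_graph_D(3)[OF \<Gamma>] E_closed(2))
  then have mem: "(x, y) \<in> \<Gamma>'" unfolding \<Gamma>'_def by (force simp: poly_monom)
  have "embedding_graph \<Gamma>'"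
    unfolding embedding_graph_def
  proof (intro conjI allI impI ballI)
    show "\<Gamma>' \<subseteq> A \<times> A"
      using poly_over_poly[OF sub_A] A embedding_graph_D(1,2)[OF \<Gamma>]
      unfolding \<Gamma>'_def coeffwise_def poly_over_def by blast
    show "(c, c) \<in> \<Gamma>'" if "c \<in> E" for c using that sub embedding_graph_D(3)[OF \<Gamma>] by blast
    fix a b a' b' assume "(a, b) \<in> \<Gamma>'" "(a', b') \<in> \<Gamma>'"
    then obtain P R P' R' where *: "a = poly P x" "b = poly R y" "coeffwise \<Gamma> P R"
      "a' = poly P' x" "b' = poly R' y" "coeffwise \<Gamma> P' R'" unfolding \<Gamma>'_def by blast
    show "(a + a', b + b') \<in> \<Gamma>'" "(a * a', b * b') \<in> \<Gamma>'"
      using coeffwise_ops[OF \<Gamma> *(3,6)] *(1,2,4,5) unfolding \<Gamma>'_def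
      by (metis (mono_tags, lifting) mem_Collect_eq poly_add, metis (mono_tags, lifting) mem_Collect_eq poly_mult)
  next
    fix w assume "(0, w) \<in> \<Gamma>'"
    then show "w = 0"
      unfolding \<Gamma>'_def using coeffwise_root[OF \<Gamma> rel0 \<open>P0 \<noteq> 0\<close> x y minimal] by force
  qed
  then show ?thesis using sub mem by blast
qed

lemma embedding_graph_Id: "embedding_graph (Id_on E)"
  unfolding embedding_graph_def using E_A by (auto simp: E_closed)

lemma coeffwise_Id: "coeffwise (Id_on E) P R \<longleftrightarrow> poly_over E P \<and> R = P"
  by (auto simp: coeffwise_def poly_over_def poly_eq_iff Id_on_iff)

text \<open>Zorn's lemma. A maximal graph has full domain, because any \<open>x\<close> can be
  adjoined by sending it to a root in \<open>A\<close> of the image of its minimal polynomial over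
  the domain.\<close>

lemma maximal_embedding_graph:
  assumes "embedding_graph \<Gamma>0"
  obtains \<Gamma> where "embedding_graph \<Gamma>" "\<Gamma>0 \<subseteq> \<Gamma>" "fst ` \<Gamma> = A"
proof -
  define S where "S = {\<Gamma>. embedding_graph \<Gamma> \<and> \<Gamma>0 \<subseteq> \<Gamma>}"
  have "\<exists>M\<in>S. \<forall>Y\<in>S. M \<subseteq> Y \<longrightarrow> Y = M"
  proof (rule subset_Zorn_nonempty)
    show "S \<noteq> {}" using assms by (auto simp: S_def)
    fix C assume C: "C \<noteq> {}" "subset.chain S C"
    have mem: "embedding_graph Y" "\<Gamma>0 \<subseteq> Y" if "Y \<in> C" for Y
      using that C(2) by (auto simp: S_def subset.chain_def)
    have two: "\<exists>Y\<in>C. u \<in> Y \<and> v \<in> Y" if "u \<in> \<Union>C" "v \<in> \<Union>C" for u v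
      using that C(2) unfolding subset_chain_def by blast
    have "embedding_graph (\<Union>C)"
      unfolding embedding_graph_def
    proof (intro conjI allI impI ballI)
      show "\<Union>C \<subseteq> A \<times> A" using mem(1) unfolding embedding_graph_def by blast
      show "(c, c) \<in> \<Union>C" if "c \<in> E" for c
        using C(1) embedding_graph_D(3)[OF mem(1) that] by blast
      show "w = 0" if "(0, w) \<in> \<Union>C" for w
        using that embedding_graph_D(6)[OF mem(1)] by blast
      fix a b a' b' assume "(a, b) \<in> \<Union>C" "(a', b') \<in> \<Union>C"
      then obtain Y where Y: "Y \<in> C" "(a, b) \<in> Y" "(a', b') \<in> Y" using two by blast
      show "(a + a', b + b') \<in> \<Union>C" "(a * a', b * b') \<in> \<Union>C"
        using embedding_graph_D(4,5)[OF mem(1)[OF Y(1)] Y(2,3)] Y(1) by blast+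
    qed
    then show "\<Union>C \<in> S" using C(1) mem(2) by (auto simp: S_def)
  qed
  then obtain \<Gamma> where "\<Gamma> \<in> S" and max0: "\<forall>Y\<in>S. \<Gamma> \<subseteq> Y \<longrightarrow> Y = \<Gamma>" by (rule bexE)
  then have \<Gamma>: "embedding_graph \<Gamma>" "\<Gamma>0 \<subseteq> \<Gamma>" by (simp_all add: S_def)
  have max: "Y = \<Gamma>" if "embedding_graph Y" "\<Gamma> \<subseteq> Y" for Y
  proof -
    have "Y \<in> S" using that \<Gamma>(2) unfolding S_def by (blast intro: order.trans)
    then show ?thesis using max0 that(2) by simp
  qed
  have "x \<in> fst ` \<Gamma>" if xA: "x \<in> A" for x
  proof -
    \<comment> \<open>The minimum is taken over pairs, so that the image \<open>R0\<close> of the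
      minimal polynomial comes along with it.\<close>
    define ann where "ann = (\<lambda>(P, R). coeffwise \<Gamma> P R \<and> P \<noteq> 0 \<and> poly P x = 0)"
    obtain P where P: "poly_over E P" "P \<noteq> 0" "poly P x = 0" using alg[OF xA] by blast
    have "ann (P, P)"
      using P embedding_graph_D(3)[OF \<Gamma>(1)] by (auto simp: ann_def coeffwise_def poly_over_def)
    then obtain PR where PR: "is_arg_min (degree \<circ> fst) ann PR"
      using is_arg_min_arg_min_nat[of ann] by blast
    obtain P0 R0 where "PR = (P0, R0)" by force
    with PR have P0: "coeffwise \<Gamma> P0 R0" "P0 \<noteq> 0" "poly P0 x = 0"
      "\<And>P R. coeffwise \<Gamma> P R \<Longrightarrow> P \<noteq> 0 \<Longrightarrow> poly P x = 0 \<Longrightarrow> degree P0 \<le> degree P"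
      by (auto simp: is_arg_min_linorder ann_def)
    have "degree P0 > 0"
      using P0(2,3) by (metis degree_eq_zeroE neq0_conv poly_const_conv pCons_0_0)
    moreover have "poly_over A R0"
      using P0(1) embedding_graph_D(2)[OF \<Gamma>(1)] unfolding coeffwise_def poly_over_def by blast
    ultimately obtain y where y: "y \<in> A" "poly R0 y = 0"
      using root coeffwise_degree[OF \<Gamma>(1) P0(1)] by metis
    have "\<exists>\<Gamma>'. embedding_graph \<Gamma>' \<and> \<Gamma> \<subseteq> \<Gamma>' \<and> (x, y) \<in> \<Gamma>'"
      by (rule embedding_graph_extend[OF \<Gamma>(1) P0(1-3) y(2) xA y(1)]) (rule P0(4))
    then show ?thesis using max by force
  qed
  then have "fst ` \<Gamma> = A" using embedding_graph_D(1)[OF \<Gamma>(1)] by force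
  then show ?thesis using that \<Gamma> by blast
qed

text \<open>The identity on \<open>E\<close> is first extended by sending \<open>x\<close> to
  \<open>y\<close>, both being roots of the minimal polynomial \<open>P\<close>, and then to all of
  \<open>A\<close>.\<close>

lemma conjugation_exists:
  assumes P: "poly_over E P" "P \<noteq> 0" "poly P x = 0" "poly P y = 0" and A: "x \<in> A" "y \<in> A"
    and minimal: "\<And>Q. poly_over E Q \<Longrightarrow> Q \<noteq> 0 \<Longrightarrow> poly Q x = 0 \<Longrightarrow> degree P \<le> degree Q"
  obtains \<sigma> where "bij_betw \<sigma> A A" "\<And>a b. a \<in> A \<Longrightarrow> b \<in> A \<Longrightarrow> \<sigma> (a + b) = \<sigma> a + \<sigma> b"
    "\<And>a b. a \<in> A \<Longrightarrow> b \<in> A \<Longrightarrow> \<sigma> (a * b) = \<sigma> a * \<sigma> b" "\<And>c. c \<in> E \<Longrightarrow> \<sigma> c = c" "\<sigma> x = y"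
proof -
  have "\<exists>\<Gamma>'. embedding_graph \<Gamma>' \<and> Id_on E \<subseteq> \<Gamma>' \<and> (x, y) \<in> \<Gamma>'"
    by (rule embedding_graph_extend[OF embedding_graph_Id, of P P])
      (simp_all add: P A minimal coeffwise_Id)
  then obtain \<Gamma>0 where \<Gamma>0: "embedding_graph \<Gamma>0" "Id_on E \<subseteq> \<Gamma>0" "(x, y) \<in> \<Gamma>0"
    by blast
  obtain \<Gamma> where \<Gamma>: "embedding_graph \<Gamma>" "\<Gamma>0 \<subseteq> \<Gamma>" "fst ` \<Gamma> = A"
    using maximal_embedding_graph[OF \<Gamma>0(1)] .
  define \<sigma> where "\<sigma> a = (THE b. (a, b) \<in> \<Gamma>)" for a
  have \<sigma>_eq: "\<sigma> a = b" if "(a, b) \<in> \<Gamma>" for a b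
    unfolding \<sigma>_def using that embedding_graph_unique[OF \<Gamma>(1)] by blast
  have \<sigma>_mem: "(a, \<sigma> a) \<in> \<Gamma>" if "a \<in> A" for a
    using that \<Gamma>(3) \<sigma>_eq by force
  note D = embedding_graph_D[OF \<Gamma>(1)]
  have inj: "inj_on \<sigma> A"
  proof (rule inj_onI)
    fix a b assume "a \<in> A" "b \<in> A" "\<sigma> a = \<sigma> b"
    then have "(a - b, 0) \<in> \<Gamma>"
      using embedding_graph_minus[OF \<Gamma>(1) \<sigma>_mem \<sigma>_mem, of a b] by simp
    then show "a = b" using embedding_graph_injective[OF \<Gamma>(1)] by force
  qed
  have "\<sigma> ` A = A"
  proof
    show "\<sigma> ` A \<subseteq> A" using \<sigma>_mem D(2) by blast
    show "A \<subseteq> \<sigma> ` A"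
    proof
      fix b assume "b \<in> A"
      then obtain Q where Q: "poly_over E Q" "Q \<noteq> 0" "poly Q b = 0" using alg by blast
      \<comment> \<open>Injectivity turns into surjectivity on the finite set of roots of
        \<open>Q\<close> in \<open>A\<close>, which \<open>\<sigma>\<close> preserves.\<close>
      define S where "S = {z \<in> A. poly Q z = 0}"
      have "finite S" using poly_roots_finite[OF Q(2)] unfolding S_def by (rule rev_finite_subset) auto
      moreover have "\<sigma> ` S \<subseteq> S"
      proof clarify
        fix z assume z: "z \<in> S"
        then have "z \<in> A" by (simp add: S_def)
        then have "(poly Q z, poly Q (\<sigma> z)) \<in> \<Gamma>"
          using embedding_graph_poly[OF \<Gamma>(1) \<sigma>_mem Q(1)] by blast
        then show "\<sigma> z \<in> S" using z \<sigma>_mem D(2,6) unfolding S_def by fastforce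
      qed
      moreover have "inj_on \<sigma> S" using inj by (rule inj_on_subset) (auto simp: S_def)
      ultimately have "\<sigma> ` S = S" by (rule endo_inj_surj)
      then show "b \<in> \<sigma> ` A" using \<open>b \<in> A\<close> Q(3) unfolding S_def by blast
    qed
  qed
  then have "bij_betw \<sigma> A A" using inj by (simp add: bij_betw_def)
  moreover have "\<sigma> (a + b) = \<sigma> a + \<sigma> b" "\<sigma> (a * b) = \<sigma> a * \<sigma> b" if "a \<in> A" "b \<in> A" for a b
    by (intro \<sigma>_eq D(4,5) \<sigma>_mem that)+
  moreover have "\<sigma> c = c" if "c \<in> E" for c by (intro \<sigma>_eq D(3) that)
  moreover have "\<sigma> x = y" by (rule \<sigma>_eq) (use \<Gamma>0(3) \<Gamma>(2) in blast)
  ultimately show ?thesis using that by blast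
qed

lemma splits:
  assumes "poly_over A P" "P \<noteq> 0"
  shows "\<exists>rs. set rs \<subseteq> A \<and> P = smult (lead_coeff P) (\<Prod>r\<leftarrow>rs. [:- r, 1:])"
  using assms
proof (induction "degree P" arbitrary: P)
  case 0
  then obtain c where "P = [:c:]" by (metis degree_eq_zeroE)
  then show ?case by (intro exI[of _ "[]"]) simp
next
  case (Suc n)
  then obtain x where x: "x \<in> A" "poly P x = 0" using root[of P] by auto
  define Q where "Q = synthetic_div P x"
  have PQ: "P = [:- x, 1:] * Q"
    using synthetic_div_correct'[of x P] x(2) by (simp add: Q_def)
  have "poly_over A (synthetic_div P' x)" if "poly_over A P'" for P'
    using that
  proof (induction P')
    case (pCons a P')
    then show ?case
      using poly_over_poly[OF sub_A _ x(1)] by (simp add: poly_over_pCons)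
  qed (simp add: poly_over_0 A_closed)
  then have "poly_over A Q" using Suc.prems(1) by (simp add: Q_def)
  moreover have "Q \<noteq> 0" using PQ Suc.prems(2) by auto
  moreover have "n = degree Q" using Suc.hyps(2) by (simp add: Q_def degree_synthetic_div)
  ultimately obtain rs where rs: "set rs \<subseteq> A" "Q = smult (lead_coeff Q) (\<Prod>r\<leftarrow>rs. [:- r, 1:])"
    using Suc.hyps(1) by blast
  have "lead_coeff P = lead_coeff Q" unfolding PQ lead_coeff_mult by simp
  then have "P = [:- x, 1:] * smult (lead_coeff P) (\<Prod>r\<leftarrow>rs. [:- r, 1:])"
    using PQ by (simp only: rs(2)[symmetric])
  then have "P = smult (lead_coeff P) (\<Prod>r\<leftarrow>x # rs. [:- r, 1:])"
    by (simp only: mult_smult_right list.map prod_list.Cons)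
  moreover have "set (x # rs) \<subseteq> A" using rs(1) x(1) by simp
  ultimately show ?case by blast
qed

end

section \<open>The absolute value\<close>

context padic_complex_field
begin

lemma absv_0 [simp]: "absv (0::'a) = 0"
  by (simp add: absv_def)

lemma absv_nonneg [simp]: "absv (x::'a) \<ge> 0"
  by (simp add: absv_def)

lemma absv_eq_0_iff [simp]: "absv (x::'a) = 0 \<longleftrightarrow> x = 0"
  by (simp add: absv_def)

lemma absv_pos_iff [simp]: "absv (x::'a) > 0 \<longleftrightarrow> x \<noteq> 0"
  by (simp add: less_le)

lemma absv_1 [simp]: "absv (1::'a) = 1"
  using absv_mult[of "1::'a" 1] by simp

text \<open>Symmetry of the metric: \<open>absv (- x)\<close> is the distance from 0 to
  \<open>x\<close>.\<close>

lemma absv_minus [simp]: "absv (- x::'a) = absv x"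
  using dist_commute[of x 0] dist_eq_absv[of 0 x] by (simp add: absv_def)

lemma absv_minus_commute: "absv (x - y::'a) = absv (y - x)"
  using absv_minus[of "x - y"] by simp

lemma absv_power: "absv (x ^ n::'a) = absv x ^ n"
  by (induction n) (auto simp: absv_mult)

lemma absv_inverse: "absv (inverse x::'a) = inverse (absv x)"
proof (cases "x = 0")
  case False
  then have "absv x * absv (inverse x) = 1" by (simp flip: absv_mult)
  then show ?thesis by (metis inverse_unique)
qed simp

lemma absv_divide: "absv (x / y::'a) = absv x / absv y"
  by (simp add: divide_inverse absv_mult absv_inverse)

lemma absv_diff_le: "absv (x - y::'a) \<le> max (absv x) (absv y)"
  using absv_add_le[of x "- y"] by simp

lemma absv_add_eq: "absv y < absv x \<Longrightarrow> absv (x + y::'a) = absv x"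
  using absv_add_le[of x y] absv_diff_le[of "x + y" y] by (auto simp: max_def split: if_splits)

lemma absv_diff_eq: "absv y < absv x \<Longrightarrow> absv (x - y::'a) = absv x"
  using absv_add_eq[of "- y" x] by simp

lemma absv_prod_list: "absv (prod_list xs::'a) = (\<Prod>x\<leftarrow>xs. absv x)"
  by (induction xs) (auto simp: absv_mult)

lemma absv_of_nat_le: "absv (of_nat n::'a) \<le> 1"
  by (induction n) (auto intro: order.trans[OF absv_add_le])

lemma absv_of_nat_eq_1: "\<not> p dvd n \<Longrightarrow> absv (of_nat n::'a) = 1"
  using absv_of_nat[of n] by (cases "n = 0") (auto simp: not_dvd_imp_multiplicity_0)

lemma absv_p: "absv (of_nat p::'a) = 1 / p"
  using absv_of_nat[of p] prime_p by (simp add: prime_gt_0_nat prime_gt_1_nat)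

lemma p_gt_1: "p > 1"
  using prime_gt_1_nat[OF prime_p] by simp

section \<open>Fields of algebraic numbers\<close>

text \<open>The locale provides \<open>Qp\<close> as a subfield of \<open>Qp_bar_ring\<close>, whose
  negatives and inverses are formed inside the carrier \<open>Qp_bar\<close>; uniqueness identifies
  them with those of the type.\<close>

lemma subfield_Qp: "subfield (Qp :: 'a set) Cp_ring"
proof -
  interpret L: subfield "Qp :: 'a set" Qp_bar_ring
    using Qp_bar_alg_closure unfolding algebraic_closure_def by blast
  interpret R: ring "Qp_bar_ring :: 'a ring"
    using Qp_bar_alg_closure unfolding algebraic_closure_def field_def domain_def cring_def by blast
  have sub: "Qp \<subseteq> (Qp_bar :: 'a set)" using L.subset by simp
  have 1: "1 \<in> (Qp :: 'a set)" using L.one_closed by simp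
  have uminus: "- x \<in> Qp" if "x \<in> Qp" for x :: 'a
  proof -
    have "x + a_inv Qp_bar_ring x = 0" using R.r_neg[of x] that sub by auto
    then have "a_inv Qp_bar_ring x = - x" by (simp add: add_eq_0_iff)
    then show ?thesis using subringE(5)[OF subfieldE(1)[OF L.subfield_axioms] that] by simp
  qed
  have inverse: "inverse x \<in> Qp" if "x \<in> Qp" "x \<noteq> 0" for x :: 'a
  proof -
    have "x * m_inv Qp_bar_ring x = 1"
      using R.subfield_m_inv(2)[OF L.subfield_axioms, of x] that by simp
    then have "m_inv Qp_bar_ring x = inverse x" by (metis inverse_unique)
    then show ?thesis using R.subfield_m_inv(1)[OF L.subfield_axioms, of x] that by simp
  qed
  have mult: "x * y \<in> Qp" if "x \<in> Qp" "y \<in> Qp" for x y :: 'a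
    using subringE(6)[OF subfieldE(1)[OF L.subfield_axioms] that] by simp
  have add: "x + y \<in> Qp" if "x \<in> Qp" "y \<in> Qp" for x y :: 'a
    using subringE(7)[OF subfieldE(1)[OF L.subfield_axioms] that] by simp
  show ?thesis
    by (rule field.subfieldI'[OF field_from_type_algebra Cp.subringI])
      (auto simp: 1 uminus mult add inverse)
qed

lemma Qp_bar_iff: "x \<in> Qp_bar \<longleftrightarrow> (\<exists>P. poly_over Qp P \<and> P \<noteq> 0 \<and> poly P (x::'a) = 0)"
  unfolding Qp_bar_def using algebraic_Cp_iff[OF subfield_Qp] by simp

lemma subfield_Qp_bar: "subfield (Qp_bar :: 'a set) Cp_ring"
  using field.subfield_of_algebraics[OF field_from_type_algebra subfield_Qp]
  by (simp add: Qp_bar_def)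

lemma Qp_subset_Qp_bar: "Qp \<subseteq> (Qp_bar :: 'a set)"
  using Cp.algebraic_self[OF subfieldE(1)[OF subfield_Qp]] by (auto simp: Qp_bar_def)

text \<open>A split polynomial has as many roots, with multiplicity, as its degree.\<close>

lemma Qp_bar_root:
  assumes "poly_over Qp_bar P" "degree P > 0"
  shows "\<exists>x\<in>Qp_bar. poly P (x::'a) = 0"
proof -
  interpret L: algebraic_closure "Qp_bar_ring :: 'a ring" Qp
    by (rule Qp_bar_alg_closure)
  note sub = subfieldE(1)[OF subfield_Qp_bar]
  define q where "q = rev (coeffs P)"
  have q: "q \<in> carrier (univ_poly Qp_bar_ring (carrier Qp_bar_ring))"
    using Cp_list_of_poly[OF subfield_Qp_bar assms(1)] Cp.univ_poly_consistent[OF sub]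
    by (simp add: q_def)
  have "L.splitted q" using L.roots_over_carrier[OF q] .
  moreover have "Polynomials.degree q > 0"
    using assms(2) by (auto simp: q_def degree_eq_length_coeffs)
  ultimately have "L.roots q \<noteq> {#}" unfolding L.splitted_def by auto
  then obtain x where "x \<in># L.roots q" by blast
  then have "L.is_root q x" using L.roots_mem_iff_is_root[OF q] by auto
  then have "x \<in> Qp_bar" "ring.eval Cp_ring q x = 0"
    using Cp.eval_consistent[OF sub] by (simp_all add: L.is_root_def)
  then show ?thesis by (auto simp: eval_Cp q_def)
qed

end

locale padic_subfield = padic_complex_field p for p +
  fixes E :: "'a::{field_char_0, complete_space} set"
  assumes subfield_E: "subfield E Cp_ring" and Qp_subset: "Qp \<subseteq> E" and E_subset: "E \<subseteq> Qp_bar"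
begin

sublocale relative_algebraic_closure E Qp_bar
proof (rule relative_algebraic_closure.intro)
  show "\<exists>P. poly_over E P \<and> P \<noteq> 0 \<and> poly P x = 0" if "x \<in> Qp_bar" for x
    using that Qp_bar_iff poly_over_mono[OF Qp_subset] by blast
qed (fact subfield_E subfield_Qp_bar E_subset Qp_bar_root)+

end

section \<open>Finite-dimensional subspaces over a complete subfield\<close>

context padic_complex_field
begin

text \<open>Some ball of radius \<open>\<delta>\<close> around \<open>u\<close> misses
  \<open>W\<close>; scaling by \<open>c\<close> turns this into a bound for the coordinate
  \<open>c\<close> of \<open>c * u + w\<close>, so coordinates depend continuously on
  vectors.\<close>

lemma closed_subspace_distance:
  assumes K: "subfield (K::'a set) Cp_ring" and W: "closed W"
    and smult: "\<And>c w. c \<in> K \<Longrightarrow> w \<in> W \<Longrightarrow> c * w \<in> W" and u: "u \<notin> W"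
  obtains \<delta> where "\<delta> > 0" "\<And>c w. c \<in> K \<Longrightarrow> w \<in> W \<Longrightarrow> \<delta> * absv c \<le> absv (c * u + w)"
proof -
  have "open (- W)" "u \<in> - W" using W u by (auto simp: open_Compl)
  then obtain \<delta> where \<delta>: "\<delta> > 0" "ball u \<delta> \<subseteq> - W" by (meson open_contains_ball)
  have "\<delta> * absv c \<le> absv (c * u + w)" if "c \<in> K" "w \<in> W" for c w
  proof (cases "c = 0")
    case False
    have "(- inverse c) * w \<in> W"
      by (intro smult that subfield_Cp_closed[OF K])
    then have "(- inverse c) * w \<notin> ball u \<delta>" using \<delta>(2) by blast
    then have "\<delta> \<le> absv (u + inverse c * w)" by (simp add: dist_eq_absv)
    then have "absv c * \<delta> \<le> absv c * absv (u + inverse c * w)"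
      by (intro mult_left_mono) auto
    also have "\<dots> = absv (c * (u + inverse c * w))" by (simp add: absv_mult)
    also have "c * (u + inverse c * w) = c * u + w"
      using False by (simp add: distrib_left flip: mult.assoc)
    finally show ?thesis by (simp add: mult.commute)
  qed simp
  then show ?thesis using that \<delta>(1) by blast
qed

text \<open>Induction on the generators: in a convergent sequence the coordinates along the new
  generator are Cauchy by the distance bound. Their limit lies in the closed \<open>K\<close>, and
  what remains converges in the closed span of the other generators.\<close>

lemma closed_Span:
  assumes K: "subfield (K::'a set) Cp_ring" and "closed K"
  shows "closed (ring.Span Cp_ring K Us)"
proof (induction Us)
  case Nil
  then show ?case by simp
next
  case (Cons u Us)
  define W where "W = ring.Span Cp_ring K Us"
  show ?case
  proof (cases "u \<in> W")
    case True
    have "c * u + w \<in> W" if "c \<in> K" "w \<in> W" for c w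
      by (intro Span_Cp_closed[OF K, where Us = Us, folded W_def] that True)
    moreover have "w = 0 * u + w" for w by simp
    ultimately have "ring.Span Cp_ring K (u # Us) = W"
      unfolding set_eq_iff Span_Cp_Cons W_def[symmetric] using subfield_Cp_closed(1)[OF K] by blast
    then show ?thesis using Cons by (simp add: W_def)
  next
    case False
    obtain \<delta> where \<delta>: "\<delta> > 0" "\<And>c w. c \<in> K \<Longrightarrow> w \<in> W \<Longrightarrow> \<delta> * absv c \<le> absv (c * u + w)"
      using closed_subspace_distance[OF K Cons[folded W_def] Span_Cp_closed(4)[OF K, where Us = Us, folded W_def] False]
      by blast
    show ?thesis
      unfolding closed_sequential_limits
    proof (intro allI impI, elim conjE)
      fix x l assume x: "\<forall>n. x n \<in> ring.Span Cp_ring K (u # Us)" and lim: "x \<longlonglongrightarrow> l"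
      have "\<forall>n. \<exists>c w. c \<in> K \<and> w \<in> W \<and> x n = c * u + w"
        using x unfolding Span_Cp_Cons W_def by blast
      then obtain c w where cw: "\<And>n. c n \<in> K" "\<And>n. w n \<in> W" "\<And>n. x n = c n * u + w n"
        by metis
      have dist_c: "\<delta> * dist (c m) (c n) \<le> dist (x m) (x n)" for m n
      proof -
        have "\<delta> * absv (c m - c n) \<le> absv ((c m - c n) * u + (w m - w n))"
          by (intro \<delta>(2) subfield_Cp_closed(5)[OF K] Span_Cp_closed(3)[OF K, where Us = Us, folded W_def] cw)
        also have "(c m - c n) * u + (w m - w n) = x m - x n" by (simp add: cw(3) algebra_simps)
        finally show ?thesis by (simp add: dist_eq_absv)
      qed
      have "Cauchy c"
      proof (rule metric_CauchyI)
        fix e :: real assume "e > 0"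
        then have "\<delta> * e > 0" using \<delta>(1) by simp
        then obtain M where M: "\<And>m n. m \<ge> M \<Longrightarrow> n \<ge> M \<Longrightarrow> dist (x m) (x n) < \<delta> * e"
          using LIMSEQ_imp_Cauchy[OF lim] unfolding Cauchy_def by metis
        have "dist (c m) (c n) < e" if "m \<ge> M" "n \<ge> M" for m n
          using M[OF that] dist_c[of m n] \<delta>(1) by (meson le_less_trans mult_less_cancel_left_pos)
        then show "\<exists>M. \<forall>m\<ge>M. \<forall>n\<ge>M. dist (c m) (c n) < e" by blast
      qed
      then obtain d where d: "c \<longlonglongrightarrow> d" using Cauchy_convergent convergent_def by blast
      have "d \<in> K" using closed_sequentially[OF \<open>closed K\<close>] cw(1) d by blast
      have "w \<longlonglongrightarrow> l - d * u"
        unfolding tendsto_dist_iff[of w]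
      proof (rule tendsto_sandwich[OF _ _ tendsto_const])
        have "dist (w n) (l - d * u) \<le> dist (x n) l + dist (c n) d * absv u" for n
        proof -
          have "w n - (l - d * u) = (x n - l) - (c n - d) * u" by (simp add: cw(3) algebra_simps)
          then have "dist (w n) (l - d * u) \<le> max (dist (x n) l) (dist (c n) d * absv u)"
            using absv_diff_le[of "x n - l" "(c n - d) * u"]
            by (simp only: dist_eq_absv absv_mult)
          then show ?thesis by (smt (verit) absv_nonneg mult_nonneg_nonneg zero_le_dist)
        qed
        then show "\<forall>\<^sub>F n in sequentially. dist (w n) (l - d * u) \<le> dist (x n) l + dist (c n) d * absv u"
          by simp
        have "(\<lambda>n. dist (x n) l + dist (c n) d * absv u) \<longlonglongrightarrow> 0 + 0 * absv u"
          using lim d unfolding tendsto_dist_iff[of x] tendsto_dist_iff[of c] by (intro tendsto_intros)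
        then show "(\<lambda>n. dist (x n) l + dist (c n) d * absv u) \<longlonglongrightarrow> 0" by simp
      qed simp
      then have "l - d * u \<in> W"
        using closed_sequentially[OF Cons[folded W_def]] cw(2) by blast
      moreover have "l = d * u + (l - d * u)" by simp
      ultimately show "l \<in> ring.Span Cp_ring K (u # Us)"
        unfolding Span_Cp_Cons W_def using \<open>d \<in> K\<close> by blast
    qed
  qed
qed

text \<open>The distance bound controls both parts of \<open>c * u + w\<close> by the absolute value
  of the whole vector, so each new generator only enlarges the constant.\<close>

lemma bounded_on_Span:
  assumes K: "subfield (K::'a set) Cp_ring" "closed K" and L: "subfield L Cp_ring" "K \<subseteq> L"
    and add: "\<And>a b. a \<in> L \<Longrightarrow> b \<in> L \<Longrightarrow> \<sigma> (a + b) = \<sigma> a + \<sigma> b"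
    and mult: "\<And>a b. a \<in> L \<Longrightarrow> b \<in> L \<Longrightarrow> \<sigma> (a * b) = \<sigma> a * (\<sigma> b :: 'a)"
    and fixed: "\<And>c. c \<in> K \<Longrightarrow> \<sigma> c = c"
    and "set Us \<subseteq> L"
  shows "\<exists>C\<ge>0. \<forall>v\<in>ring.Span Cp_ring K Us. absv (\<sigma> v) \<le> C * absv v"
  using \<open>set Us \<subseteq> L\<close>
proof (induction Us)
  case Nil
  then show ?case using fixed[of 0] subfield_Cp_closed(1)[OF K(1)] by (intro exI[of _ 0]) auto
next
  case (Cons u Us)
  define W where "W = ring.Span Cp_ring K Us"
  have WL: "W \<subseteq> L" unfolding W_def using Cons.prems by (intro Span_Cp_subset[OF L]) simp
  obtain C where C: "C \<ge> 0" "\<And>v. v \<in> W \<Longrightarrow> absv (\<sigma> v) \<le> C * absv v"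
    using Cons unfolding W_def by auto
  show ?case
  proof (cases "u \<in> W")
    case True
    have "c * u + w \<in> W" if "c \<in> K" "w \<in> W" for c w
      by (intro Span_Cp_closed[OF K(1), where Us = Us, folded W_def] that True)
    then have "ring.Span Cp_ring K (u # Us) \<subseteq> W"
      unfolding Span_Cp_Cons W_def[symmetric] subset_iff by blast
    then show ?thesis using C by blast
  next
    case False
    have "closed W" unfolding W_def by (rule closed_Span[OF K])
    then obtain \<delta> where \<delta>: "\<delta> > 0" "\<And>c w. c \<in> K \<Longrightarrow> w \<in> W \<Longrightarrow> \<delta> * absv c \<le> absv (c * u + w)"
      using closed_subspace_distance[OF K(1) _ Span_Cp_closed(4)[OF K(1), where Us = Us, folded W_def] False]
      by blast
    \<comment> \<open>Obtained by inserting the bounds \<open>absv v / \<delta>\<close> for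
      \<open>c\<close> and \<open>absv v + absv v / \<delta> * absv u\<close> for
      \<open>w\<close>.\<close>
    define M where "M = absv (\<sigma> u) / \<delta> + C * (1 + absv u / \<delta>)"
    have "M \<ge> 0" unfolding M_def using C(1) \<delta>(1) by simp
    moreover have "absv (\<sigma> v) \<le> M * absv v" if v: "v \<in> ring.Span Cp_ring K (u # Us)" for v
    proof -
      obtain c w where cw: "c \<in> K" "w \<in> W" "v = c * u + w"
        using v unfolding Span_Cp_Cons W_def by blast
      have c: "absv c \<le> absv v / \<delta>" using \<delta>(2)[OF cw(1,2)] \<delta>(1) cw(3) by (simp add: field_simps)
      have mem: "c \<in> L" "u \<in> L" "c * u \<in> L" "w \<in> L"
        using cw WL L Cons.prems subfield_Cp_closed(6)[OF L(1), of c u] by auto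
      have "absv w = absv (v - c * u)" using cw(3) by simp
      also have "\<dots> \<le> max (absv v) (absv (c * u))" by (rule absv_diff_le)
      also have "\<dots> \<le> absv v + absv v / \<delta> * absv u"
        using mult_right_mono[OF c, of "absv u"] \<delta>(1) absv_nonneg[of v]
        by (auto simp: absv_mult intro: add_increasing)
      finally have w: "absv w \<le> absv v + absv v / \<delta> * absv u" .
      have "\<sigma> v = c * \<sigma> u + \<sigma> w" using add mult fixed mem cw by metis
      then have "absv (\<sigma> v) \<le> max (absv c * absv (\<sigma> u)) (absv (\<sigma> w))"
        using absv_add_le[of "c * \<sigma> u" "\<sigma> w"] by (simp add: absv_mult)
      also have "\<dots> \<le> absv c * absv (\<sigma> u) + absv (\<sigma> w)"
        using mult_nonneg_nonneg[OF absv_nonneg absv_nonneg, of c "\<sigma> u"] absv_nonneg[of "\<sigma> w"]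
        by (simp only: max.bounded_iff) linarith
      also have "\<dots> \<le> absv v / \<delta> * absv (\<sigma> u) + C * (absv v + absv v / \<delta> * absv u)"
        using mult_right_mono[OF c, of "absv (\<sigma> u)"] C(2)[OF cw(2)] mult_left_mono[OF w C(1)]
        by simp
      also have "\<dots> = M * absv v" by (simp add: M_def algebra_simps)
      finally show ?thesis .
    qed
    ultimately show ?thesis by blast
  qed
qed

lemma closed_Qp: "closed (Qp :: 'a set)"
  by (simp add: Qp_def)

lemma le_of_power_le:
  fixes a b C :: real
  assumes "b \<ge> 0" "\<And>k. a ^ k \<le> C * b ^ k"
  shows "a \<le> b"
proof (rule ccontr)
  assume "\<not> a \<le> b"
  show False
  proof (cases "b = 0")
    case True
    then show ?thesis using assms(2)[of 1] \<open>\<not> a \<le> b\<close> by simp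
  next
    case False
    then have "b > 0" "a / b > 1" using assms(1) \<open>\<not> a \<le> b\<close> by auto
    then obtain k where "C < (a / b) ^ k" using real_arch_pow by blast
    then show False
      using assms(2)[of k] \<open>b > 0\<close> by (simp add: power_divide pos_less_divide_eq)
  qed
qed

text \<open>On the simple extension generated by \<open>x\<close> the map is bounded with some
  constant \<open>C\<close>; applying this to all powers of \<open>x\<close> and comparing growth
  makes \<open>C\<close> disappear.\<close>

lemma embedding_nonexpanding:
  assumes add: "\<And>a b. a \<in> Qp_bar \<Longrightarrow> b \<in> Qp_bar \<Longrightarrow> \<sigma> (a + b) = \<sigma> a + \<sigma> b"
    and mult: "\<And>a b. a \<in> Qp_bar \<Longrightarrow> b \<in> Qp_bar \<Longrightarrow> \<sigma> (a * b) = \<sigma> a * (\<sigma> b :: 'a)"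
    and fixed: "\<And>c. c \<in> Qp \<Longrightarrow> \<sigma> c = c" and x: "x \<in> Qp_bar"
  shows "absv (\<sigma> x) \<le> absv x"
proof -
  let ?S = "ring.simple_extension Cp_ring Qp x"
  have alg: "(ring.algebraic Cp_ring over Qp) x" using x by (simp add: Qp_bar_def)
  have S: "subfield ?S Cp_ring"
    using Cp.simple_extension_is_subfield[OF subfield_Qp] alg by simp
  have xS: "x \<in> ?S" using Cp.simple_extension_mem[OF subfieldE(1)[OF subfield_Qp]] by simp
  define Us where "Us = Cp.exp_base x (Polynomials.degree (Cp.Irr Qp x))"
  have Us: "ring.Span Cp_ring Qp Us = ?S"
    unfolding Us_def using Cp.Span_exp_base[OF subfield_Qp _ alg] by simp
  have "?S \<subseteq> Qp_bar"
    using Cp.simple_extension_subring_incl[OF subfieldE(1)[OF subfield_Qp_bar] Qp_subset_Qp_bar x] .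
  then have "set Us \<subseteq> Qp_bar" using Span_Cp_closed(5)[OF subfield_Qp, of Us] Us by auto
  from bounded_on_Span[OF subfield_Qp closed_Qp subfield_Qp_bar Qp_subset_Qp_bar add mult fixed this]
  obtain C where C: "\<And>v. v \<in> ?S \<Longrightarrow> absv (\<sigma> v) \<le> C * absv v" unfolding Us by blast
  have pow: "\<sigma> (x ^ k) = \<sigma> x ^ k" for k
  proof (induction k)
    case 0
    then show ?case using fixed[OF subfield_Cp_closed(2)[OF subfield_Qp]] by simp
  next
    case (Suc k)
    then show ?case using mult[OF x subfield_Cp_closed(9)[OF subfield_Qp_bar x]] by simp
  qed
  have "absv (\<sigma> x) ^ k \<le> C * absv x ^ k" for k
    using C[OF subfield_Cp_closed(9)[OF S xS], of k] by (simp add: pow absv_power)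
  then show ?thesis by (intro le_of_power_le[of "absv x" "absv (\<sigma> x)" C]) auto
qed

end

section \<open>The Galois action on disks\<close>

context padic_subfield
begin

lemma Gal_D:
  assumes "\<sigma> \<in> Gal E"
  shows "bij_betw \<sigma> Qp_bar Qp_bar"
    "a \<in> Qp_bar \<Longrightarrow> b \<in> Qp_bar \<Longrightarrow> \<sigma> (a + b) = \<sigma> a + \<sigma> b"
    "a \<in> Qp_bar \<Longrightarrow> b \<in> Qp_bar \<Longrightarrow> \<sigma> (a * b) = \<sigma> a * \<sigma> b"
    "c \<in> E \<Longrightarrow> \<sigma> c = c"
  using assms by (auto simp: Gal_def ring_iso_def ring_hom_def)

text \<open>Neither \<open>\<sigma>\<close> nor its inverse increases absolute values.\<close>

lemma Gal_isometry:
  assumes \<sigma>: "\<sigma> \<in> Gal E" and x: "x \<in> Qp_bar"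
  shows "absv (\<sigma> x) = absv x"
proof (rule antisym)
  note D = Gal_D[OF \<sigma>]
  show "absv (\<sigma> x) \<le> absv x"
    using D(2-4) Qp_subset by (intro embedding_nonexpanding x) auto
  define \<tau> where "\<tau> = inv_into Qp_bar \<sigma>"
  have \<tau>: "\<tau> a \<in> Qp_bar" "\<sigma> (\<tau> a) = a" if "a \<in> Qp_bar" for a
    using D(1) that by (auto simp: \<tau>_def bij_betw_def inv_into_into f_inv_into_f)
  have \<tau>': "\<tau> (\<sigma> a) = a" if "a \<in> Qp_bar" for a
    using D(1) that by (simp add: \<tau>_def bij_betw_def)
  have "absv (\<tau> (\<sigma> x)) \<le> absv (\<sigma> x)"
  proof (rule embedding_nonexpanding)
    show "\<sigma> x \<in> Qp_bar" using D(1) x by (auto simp: bij_betw_def)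
    show "\<tau> c = c" if "c \<in> Qp" for c
    proof -
      have "\<sigma> c = c" using D(4) that Qp_subset by blast
      then show ?thesis using \<tau>'[of c] that Qp_subset_Qp_bar by auto
    qed
    fix a b :: 'a assume ab: "a \<in> Qp_bar" "b \<in> Qp_bar"
    have "\<sigma> (\<tau> a + \<tau> b) = a + b" "\<sigma> (\<tau> a * \<tau> b) = a * b"
      using D(2,3)[of "\<tau> a" "\<tau> b"] \<tau> ab by auto
    moreover have "\<tau> a + \<tau> b \<in> Qp_bar" "\<tau> a * \<tau> b \<in> Qp_bar"
      using \<tau>(1) ab A_closed(4,6) by blast+
    ultimately show "\<tau> (a + b) = \<tau> a + \<tau> b" "\<tau> (a * b) = \<tau> a * \<tau> b"
      using \<tau>' by metis+
  qed
  then show "absv x \<le> absv (\<sigma> x)" using \<tau>'[OF x] by simp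
qed

lemma Gal_diff:
  assumes \<sigma>: "\<sigma> \<in> Gal E" and "a \<in> Qp_bar" "b \<in> Qp_bar"
  shows "\<sigma> (a - b) = \<sigma> a - \<sigma> b"
  using Gal_D(2)[OF \<sigma>, of "a - b" b] A_closed(5)[OF assms(2,3)] assms(3) by (simp add: algebra_simps)

text \<open>An isometry of the dense subset \<open>Qp_bar\<close> is uniformly continuous, hence has
  exactly one continuous extension; this is what the definite description in \<open>gal_act\<close>
  picks.\<close>

lemma gal_act_eq:
  assumes \<sigma>: "\<sigma> \<in> Gal E" and x: "x \<in> Qp_bar"
  shows "gal_act \<sigma> x = \<sigma> x"
proof -
  have "uniformly_continuous_on Qp_bar \<sigma>"
    unfolding uniformly_continuous_on_def
  proof (intro allI impI)
    fix e :: real assume "e > 0"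
    have "dist (\<sigma> b) (\<sigma> a) = dist b a" if "a \<in> Qp_bar" "b \<in> Qp_bar" for a b
      using Gal_isometry[OF \<sigma> A_closed(5)[OF that(2,1)]] Gal_diff[OF \<sigma> that(2,1)]
      by (simp add: dist_eq_absv)
    then show "\<exists>d>0. \<forall>x\<in>Qp_bar. \<forall>x'\<in>Qp_bar. dist x' x < d \<longrightarrow> dist (\<sigma> x') (\<sigma> x) < e"
      using \<open>e > 0\<close> by (intro exI[of _ e]) auto
  qed
  then show ?thesis
  proof (rule uniformly_continuous_on_extension_on_closure)
    fix g
    assume g: "uniformly_continuous_on (closure Qp_bar) g" "\<And>x. x \<in> Qp_bar \<Longrightarrow> \<sigma> x = g x"
      and uniq: "\<And>Y h x. Qp_bar \<subseteq> Y \<Longrightarrow> Y \<subseteq> closure Qp_bar \<Longrightarrow> continuous_on Y h \<Longrightarrow>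
        (\<And>x. x \<in> Qp_bar \<Longrightarrow> \<sigma> x = h x) \<Longrightarrow> x \<in> Y \<Longrightarrow> h x = g x"
    have "gal_act \<sigma> = g"
      unfolding gal_act_def
    proof (rule the_equality)
      show "continuous_on UNIV g \<and> (\<forall>x\<in>Qp_bar. g x = \<sigma> x)"
        using uniformly_continuous_imp_continuous[OF g(1)] g(2) by (simp add: Qp_bar_dense)
      fix h assume h: "continuous_on UNIV h \<and> (\<forall>x\<in>Qp_bar. h x = \<sigma> x)"
      show "h = g"
        by (rule ext, rule uniq[of UNIV]) (use h in \<open>auto simp: Qp_bar_dense\<close>)
    qed
    then show ?thesis using g(2) x by simp
  qed
qed

lemma Gal_disk:
  assumes "defined_over E D" "\<sigma> \<in> Gal E" "x \<in> Qp_bar" "x \<in> D"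
  shows "\<sigma> x \<in> D"
  using assms gal_act_eq[OF assms(2,3)] unfolding defined_over_def by (metis imageI)

text \<open>Up to a constant factor \<open>P\<close> is the minimal polynomial of \<open>x\<close>,
  so this is transitivity of the Galois group on its roots.\<close>

lemma Gal_exists:
  assumes "poly_over E P" "P \<noteq> 0" "poly P x = 0" "poly P y = 0" "x \<in> Qp_bar" "y \<in> Qp_bar"
    and "\<And>Q. poly_over E Q \<Longrightarrow> Q \<noteq> 0 \<Longrightarrow> poly Q x = 0 \<Longrightarrow> degree P \<le> degree Q"
  shows "\<exists>\<sigma>\<in>Gal E. \<sigma> x = y"
proof -
  obtain \<sigma> where \<sigma>: "bij_betw \<sigma> Qp_bar Qp_bar"
    "\<And>a b. a \<in> Qp_bar \<Longrightarrow> b \<in> Qp_bar \<Longrightarrow> \<sigma> (a + b) = \<sigma> a + \<sigma> b"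
    "\<And>a b. a \<in> Qp_bar \<Longrightarrow> b \<in> Qp_bar \<Longrightarrow> \<sigma> (a * b) = \<sigma> a * \<sigma> b"
    "\<And>c. c \<in> E \<Longrightarrow> \<sigma> c = c" "\<sigma> x = y"
    by (rule conjugation_exists[OF assms]) blast+
  have "\<sigma> \<in> Gal E"
    using \<sigma> E_closed(2) by (auto simp: Gal_def ring_iso_def ring_hom_def bij_betw_def)
  then show ?thesis using \<sigma>(5) by blast
qed

end

section \<open>Values and residues of algebraic elements\<close>

context padic_complex_field
begin

section \<open>Values of elements algebraic over \<open>Qp\<close>\<close>

lemma rational_approximation:
  assumes "z \<in> (Qp :: 'a set)" "e > 0"
  obtains r s :: int where "s > 0" "coprime r s" "absv (z - of_int r / of_int s) < e"
proof -
  obtain q :: 'a where q: "q \<in> \<rat>" "dist q z < e"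
    using assms unfolding Qp_def closure_approachable by blast
  then obtain r s where "s > 0" "coprime r s" "q = of_int r / of_int s"
    by (auto elim: Rats_cases')
  then show ?thesis using that q(2) by (metis dist_commute dist_eq_absv)
qed

lemma absv_of_int: "absv (of_int k :: 'a) = absv (of_nat (nat \<bar>k\<bar>) :: 'a)"
  by (cases k rule: int_cases2) simp_all

lemma absv_of_int_le: "absv (of_int k :: 'a) \<le> 1"
  unfolding absv_of_int by (rule absv_of_nat_le)

lemma absv_of_int_eq_1: "\<not> int p dvd k \<Longrightarrow> absv (of_int k :: 'a) = 1"
  unfolding absv_of_int by (rule absv_of_nat_eq_1) (simp add: dvd_nat_abs_iff)

lemma absv_of_int_less_1: "int p dvd k \<Longrightarrow> absv (of_int k :: 'a) < 1"
proof -
  assume "int p dvd k"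
  then obtain l where "k = int p * l" by blast
  then have "absv (of_int k :: 'a) = absv (of_int l :: 'a) / p" by (simp add: absv_mult absv_p)
  also have "\<dots> \<le> 1 / p" using absv_of_int_le by (intro divide_right_mono) auto
  also have "\<dots> < 1" using p_gt_1 by simp
  finally show ?thesis .
qed

text \<open>A rational number closer to \<open>z\<close> than \<open>absv z\<close> has the same
  absolute value as \<open>z\<close>, and nonzero rationals have powers of \<open>p\<close> as
  values.\<close>

lemma absv_Qp:
  assumes "z \<in> (Qp :: 'a set)" "z \<noteq> 0"
  obtains k :: int where "absv z = real p powi k"
proof -
  have nat: "\<exists>j::int. absv (of_int m :: 'a) = real p powi j" if "m \<noteq> 0" for m
  proof
    have "absv (of_int m :: 'a) = 1 / real p ^ multiplicity p (nat \<bar>m\<bar>)"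
      unfolding absv_of_int using that by (intro absv_of_nat) simp
    then show "absv (of_int m :: 'a) = real p powi (- int (multiplicity p (nat \<bar>m\<bar>)))"
      by (simp add: power_int_minus inverse_eq_divide)
  qed
  obtain r s where rs: "s > 0" "absv (z - of_int r / of_int s) < absv z"
    by (rule rational_approximation[OF assms(1), of "absv z"]) (use assms(2) in auto)
  then have eq: "absv z = absv (of_int r / of_int s :: 'a)"
    using absv_diff_eq[of "z - of_int r / of_int s" z] by simp
  with assms(2) have "r \<noteq> 0" by auto
  then obtain i j where "absv (of_int r :: 'a) = real p powi i" "absv (of_int s :: 'a) = real p powi j"
    using nat rs(1) by (metis less_irrefl)
  then have "absv z = real p powi (i - j)"
    using eq p_gt_1 by (simp add: absv_divide power_int_diff)
  then show ?thesis using that by blast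
qed

text \<open>The term of largest absolute value dominates. Distinctness is asked only of nonzero
  terms, so that any number of terms may vanish.\<close>

lemma absv_sum_distinct:
  assumes "finite I"
    and "\<And>i j. i \<in> I \<Longrightarrow> j \<in> I \<Longrightarrow> i \<noteq> j \<Longrightarrow> f i \<noteq> 0 \<Longrightarrow> absv (f i) \<noteq> absv (f j :: 'a)"
  shows "(\<forall>i\<in>I. f i = 0) \<or> (\<exists>i\<in>I. f i \<noteq> 0 \<and> absv (sum f I) = absv (f i))"
  using assms
proof (induction I)
  case (insert a I)
  have IH: "(\<forall>i\<in>I. f i = 0) \<or> (\<exists>i\<in>I. f i \<noteq> 0 \<and> absv (sum f I) = absv (f i))"
    using insert.IH insert.prems by blast
  show ?case
  proof (cases "\<forall>i\<in>I. f i = 0")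
    case True
    then show ?thesis using insert.hyps by auto
  next
    case False
    then obtain i where i: "i \<in> I" "f i \<noteq> 0" "absv (sum f I) = absv (f i)" using IH by blast
    then have "absv (f a) \<noteq> absv (sum f I)"
      using insert.prems[of i a] insert.hyps by (metis insertCI)
    then consider "absv (f a) < absv (sum f I)" | "absv (sum f I) < absv (f a)" by linarith
    then show ?thesis
    proof cases
      case 1
      then have "absv (sum f (insert a I)) = absv (f i)"
        using absv_add_eq[OF 1] insert.hyps i(3) by (simp add: add.commute)
      then show ?thesis using i by blast
    next
      case 2
      then have "absv (sum f (insert a I)) = absv (f a)"
        using absv_add_eq[OF 2] insert.hyps by simp
      moreover have "f a \<noteq> 0" using le_less_trans[OF absv_nonneg 2] by simp
      ultimately show ?thesis by blast
    qed
  qed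
qed simp

text \<open>The terms of \<open>poly P x\<close> sum to 0, so two different nonzero ones have equal
  absolute value. Comparing them expresses a power of \<open>absv x\<close> by values of
  \<open>Qp\<close>, the exponent being the difference of the two indices.\<close>

lemma absv_power_algebraic:
  assumes P: "poly_over Qp P" "P \<noteq> 0" "poly P x = 0" and x: "x \<noteq> (0::'a)"
  obtains m and k :: int where "0 < m" "m \<le> degree P" "absv x ^ m = real p powi k"
proof -
  let ?f = "\<lambda>i. coeff P i * x ^ i"
  have "lead_coeff P * x ^ degree P \<noteq> 0" using P(2) x by simp
  moreover have "sum ?f {..degree P} = 0" using P(3) by (simp add: poly_altdef)
  ultimately have "\<exists>i j. i \<le> degree P \<and> j \<le> degree P \<and> i \<noteq> j \<and> ?f i \<noteq> 0 \<and> absv (?f i) = absv (?f j)"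
    using absv_sum_distinct[of "{..degree P}" ?f] by fastforce
  then obtain i j where ij: "i \<le> degree P" "j \<le> degree P" "i < j" "?f i \<noteq> 0" "absv (?f i) = absv (?f j)"
    by (metis absv_eq_0_iff linorder_neqE_nat)
  then have nz: "coeff P i \<noteq> 0" "coeff P j \<noteq> 0" by (auto simp: absv_mult)
  obtain a b where ab: "absv (coeff P i) = real p powi a" "absv (coeff P j) = real p powi b"
    using absv_Qp nz P(1) unfolding poly_over_def by metis
  have "absv (coeff P i) * absv x ^ i = absv (coeff P j) * absv x ^ (j - i) * absv x ^ i"
    using ij(3,5) by (simp add: absv_mult absv_power mult.assoc flip: power_add)
  then have "absv (coeff P i) = absv (coeff P j) * absv x ^ (j - i)" using x by simp
  then have "absv x ^ (j - i) = real p powi (a - b)"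
    using ab p_gt_1 by (simp add: power_int_diff field_simps)
  then show ?thesis using that[of "j - i"] ij by simp
qed

lemma finite_powi_range:
  fixes b s t :: real
  assumes "b > 1" "s > 0"
  shows "finite {y. (\<exists>k::int. y = b powi k) \<and> s \<le> y \<and> y \<le> t}"
proof -
  obtain n where n: "max t (1 / s) < b ^ n" using real_arch_pow[OF assms(1)] by blast
  have "k \<in> {- int n..int n}" if "s \<le> b powi k" "b powi k \<le> t" for k
  proof -
    have "b powi k < b powi int n" using that n by simp
    then have "k < int n" using assms(1) power_int_increasing[of "int n" k b] by fastforce
    moreover have "1 / s < b ^ n" using n by simp
    then have "1 / b ^ n < s" using assms by (simp add: field_simps)
    then have "b powi (- int n) < b powi k"
      using that by (simp add: power_int_minus inverse_eq_divide)
    then have "- int n < k" using assms(1) power_int_increasing[of k "- int n" b] by fastforce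
    ultimately show ?thesis by simp
  qed
  then have "{y. (\<exists>k::int. y = b powi k) \<and> s \<le> y \<and> y \<le> t} \<subseteq> (\<lambda>k. b powi k) ` {- int n..int n}"
    by blast
  then show ?thesis by (rule finite_subset) simp
qed

text \<open>The exponents for single elements all divide \<open>fact N\<close>, so raising to that
  power maps the values injectively to integral powers of \<open>p\<close> in a bounded range away
  from 0. This discreteness provides best approximations later.\<close>

lemma finite_values_bounded_degree:
  assumes "s > 0"
    and "\<And>x. x \<in> F \<Longrightarrow> \<exists>P. poly_over Qp P \<and> P \<noteq> 0 \<and> poly P (x::'a) = 0 \<and> degree P \<le> N"
  shows "finite (absv ` F \<inter> {s..t})"
proof -
  have "(\<exists>k::int. absv x ^ fact N = real p powi k) \<and> s ^ fact N \<le> absv x ^ fact N \<and> absv x ^ fact N \<le> t ^ fact N"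
    if xF: "x \<in> F" and x: "s \<le> absv x" "absv x \<le> t" for x
  proof -
    have "x \<noteq> 0" using x assms(1) by auto
    obtain P where P: "poly_over Qp P" "P \<noteq> 0" "poly P x = 0" "degree P \<le> N"
      using assms(2) xF by blast
    obtain m k where mk: "0 < m" "m \<le> degree P" "absv x ^ m = real p powi k"
      using absv_power_algebraic[OF P(1-3) \<open>x \<noteq> 0\<close>] .
    then have "m dvd fact N" using P(4) by (intro dvd_fact) auto
    then obtain l where "fact N = m * l" by blast
    then have "absv x ^ fact N = real p powi (k * int l)"
      using mk(3) by (simp add: power_mult power_int_mult)
    moreover have "s ^ fact N \<le> absv x ^ fact N" "absv x ^ fact N \<le> t ^ fact N"
      using x assms(1) by (intro power_mono; simp)+
    ultimately show ?thesis by blast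
  qed
  then have "(\<lambda>y. y ^ fact N) ` (absv ` F \<inter> {s..t}) \<subseteq>
      {y. (\<exists>k::int. y = real p powi k) \<and> s ^ fact N \<le> y \<and> y \<le> t ^ fact N}"
    by auto
  moreover have "finite {y. (\<exists>k::int. y = real p powi k) \<and> s ^ fact N \<le> y \<and> y \<le> t ^ fact N}"
    using assms(1) p_gt_1 by (intro finite_powi_range) auto
  ultimately have "finite ((\<lambda>y. y ^ fact N) ` (absv ` F \<inter> {s..t}))" by (rule finite_subset)
  moreover have "inj_on (\<lambda>y::real. y ^ fact N) (absv ` F \<inter> {s..t})"
    by (rule inj_onI) (auto intro: power_eq_imp_eq_base[of _ "fact N"])
  ultimately show ?thesis by (rule finite_imageD)
qed

section \<open>Congruences modulo the maximal ideal\<close>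

lemma cong_trans: "absv (a - b :: 'a) < 1 \<Longrightarrow> absv (b - c) < 1 \<Longrightarrow> absv (a - c) < 1"
  using absv_add_le[of "a - b" "b - c"] by auto

lemma cong_sym: "absv (a - b :: 'a) < 1 \<Longrightarrow> absv (b - a) < 1"
  by (simp add: absv_minus_commute)

lemma cong_add:
  assumes "absv (a - a' :: 'a) < 1" "absv (b - b') < 1"
  shows "absv ((a + b) - (a' + b')) < 1"
  using absv_add_le[of "a - a'" "b - b'"] assms by (simp add: algebra_simps)

lemma cong_mult:
  assumes "absv (a - a' :: 'a) < 1" "absv (b - b') < 1" "absv a \<le> 1" "absv b' \<le> 1"
  shows "absv (a * b - a' * b') < 1"
proof -
  have "absv (a * (b - b')) < 1"
    using mult_left_mono[OF assms(3), of "absv (b - b')"] assms(2) by (simp add: absv_mult mult.commute)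
  moreover have "absv ((a - a') * b') < 1"
    using mult_left_mono[OF assms(4), of "absv (a - a')"] assms(1) by (simp add: absv_mult)
  moreover have "a * b - a' * b' = a * (b - b') + (a - a') * b'" by (simp add: algebra_simps)
  ultimately show ?thesis using absv_add_le[of "a * (b - b')" "(a - a') * b'"] by simp
qed

lemma absv_power_le_1: "absv (a :: 'a) \<le> 1 \<Longrightarrow> absv (a ^ n) \<le> 1"
  by (simp add: absv_power power_le_one)

lemma cong_power:
  assumes "absv (a - b :: 'a) < 1" "absv a \<le> 1" "absv b \<le> 1"
  shows "absv (a ^ n - b ^ n) < 1"
  by (induction n) (auto intro: cong_mult absv_power_le_1 assms)

lemma absv_sum_less:
  assumes "finite I" "\<And>i. i \<in> I \<Longrightarrow> absv (f i :: 'a) < e" "e > 0"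
  shows "absv (sum f I) < e"
  using assms(1,2)
proof (induction I)
  case (insert i I)
  have "absv (f i + sum f I) \<le> max (absv (f i)) (absv (sum f I))" by (rule absv_add_le)
  also have "\<dots> < e" using insert by simp
  finally show ?case using insert by simp
qed (use assms(3) in simp)

text \<open>A fraction \<open>r / s\<close> in lowest terms that approximates \<open>z\<close> also
  has absolute value at most 1, so \<open>s\<close> is prime to \<open>p\<close> and the fraction is
  congruent to an integer.\<close>

lemma digit_exists:
  assumes "z \<in> (Qp :: 'a set)" "absv z \<le> 1"
  shows "\<exists>a<p. absv (z - of_nat a) < 1"
proof -
  obtain r s where rs: "s > 0" "coprime r s" "absv (z - of_int r / of_int s) < 1"
    by (rule rational_approximation[OF assms(1), of 1]) auto
  define q where "q = (of_int r / of_int s :: 'a)"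
  have "absv q \<le> 1"
    using absv_diff_le[of z "z - q"] assms(2) rs(3) by (simp add: q_def)
  have "\<not> int p dvd s"
  proof
    assume *: "int p dvd s"
    have "\<not> int p dvd r"
      using rs(2) * p_gt_1 by (metis coprime_common_divisor int_dvd_int_iff nat_dvd_1_iff_1 of_nat_1 order_less_irrefl)
    then have "absv q = 1 / absv (of_int s :: 'a)" by (simp add: q_def absv_divide absv_of_int_eq_1)
    moreover have "absv (of_int s :: 'a) < 1" "absv (of_int s :: 'a) > 0"
      using absv_of_int_less_1[OF *] rs(1) by auto
    ultimately show False using \<open>absv q \<le> 1\<close> by (simp add: field_simps)
  qed
  then have s1: "absv (of_int s :: 'a) = 1" by (rule absv_of_int_eq_1)
  have "coprime s (int p)"
    using \<open>\<not> int p dvd s\<close> prime_p by (metis coprime_commute prime_imp_coprime prime_nat_int_transfer)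
  then obtain t v where tv: "t * s + v * int p = 1"
    using bezout_int[of s "int p"] by auto
  \<comment> \<open>By the Bezout relation \<open>t\<close> inverts \<open>s\<close> modulo
    \<open>p\<close>, so \<open>a\<close> represents \<open>r / s\<close>.\<close>
  define a where "a = nat ((r * t) mod int p)"
  have "int a = (r * t) mod int p" using p_gt_1 by (simp add: a_def)
  then have "int a = r * t - int p * ((r * t) div int p)" by (simp add: minus_mult_div_eq_mod)
  then have "r - int a * s = r * (t * s + v * int p) - (r * t - int p * ((r * t) div int p)) * s"
    by (simp add: tv)
  also have "\<dots> = int p * (r * v + (r * t) div int p * s)" by (simp add: algebra_simps)
  finally have "int p dvd r - int a * s" by simp
  then have "absv (of_int (r - int a * s) :: 'a) < 1" by (rule absv_of_int_less_1)
  moreover have "q - of_nat a = of_int (r - int a * s) / of_int s"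
    using rs(1) by (simp add: q_def field_simps)
  ultimately have "absv (q - of_nat a) < 1" by (simp add: absv_divide s1)
  moreover have "a < p"
    using p_gt_1 by (simp add: a_def nat_less_iff)
  ultimately show ?thesis using cong_trans rs(3) unfolding q_def by blast
qed

text \<open>In the \<open>p\<close>-th power of \<open>(a - b) + b\<close> all middle terms are
  divisible by \<open>p\<close>, so the \<open>p\<close>-th power of \<open>a - b\<close> is
  congruent to the difference of the \<open>p\<close>-th powers: Frobenius is injective on
  residues.\<close>

lemma frobenius_cong_imp_cong:
  assumes "absv (a ^ p - b ^ p :: 'a) < 1" "absv a \<le> 1" "absv b \<le> 1"
  shows "absv (a - b) < 1"
proof -
  define c where "c = a - b"
  have c: "absv c \<le> 1" using absv_diff_le[of a b] assms by (simp add: c_def)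
  define m where "m = (\<Sum>k\<in>{0<..<p}. of_nat (p choose k) * c ^ k * b ^ (p - k))"
  have "absv m < 1"
    unfolding m_def
  proof (rule absv_sum_less)
    fix k assume "k \<in> {0<..<p}"
    then have "p dvd p choose k" using dvd_choose_prime[of k p] prime_p by simp
    then have "int p dvd int (p choose k)" by simp
    from absv_of_int_less_1[OF this] have *: "absv (of_nat (p choose k) :: 'a) < 1" by simp
    have "absv (c ^ k * b ^ (p - k)) \<le> 1"
      by (simp add: absv_mult absv_power_le_1 c assms mult_le_one)
    then show "absv (of_nat (p choose k) * c ^ k * b ^ (p - k)) < 1"
      using * mult_left_le[of "absv (c ^ k * b ^ (p - k))" "absv (of_nat (p choose k) :: 'a)"]
      by (simp add: absv_mult mult.assoc)
  qed auto
  have "{..p} = insert 0 (insert p {0<..<p})" using p_gt_1 by auto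
  then have "a ^ p = b ^ p + c ^ p + m"
    using binomial_ring[of c b p] p_gt_1 by (simp add: c_def m_def)
  then have "c ^ p = (a ^ p - b ^ p) - m" by simp
  then have "absv c ^ p < 1"
    using absv_diff_le[of "a ^ p - b ^ p" m] assms(1) \<open>absv m < 1\<close> by (simp flip: absv_power)
  then show ?thesis
    unfolding c_def[symmetric] by (metis absv_nonneg linorder_not_less one_le_power)
qed

lemma frobenius_power_cong_imp_cong:
  assumes "absv (a ^ (p ^ i) - b ^ (p ^ i) :: 'a) < 1" "absv a \<le> 1" "absv b \<le> 1"
  shows "absv (a - b) < 1"
  using assms(1)
proof (induction i)
  case (Suc i)
  have "absv ((a ^ (p ^ i)) ^ p - (b ^ (p ^ i)) ^ p) < 1"
    using Suc.prems by (simp add: power_mult[symmetric] mult.commute)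
  then show ?case using Suc.IH frobenius_cong_imp_cong absv_power_le_1 assms(2,3) by blast
qed simp

end

text \<open>With \<open>p ^ k\<close> the exact power of \<open>p\<close> in \<open>N\<close>, the
  binomial coefficient contains \<open>p\<close> as often as \<open>m\<close> does, that is, not at
  all; this is the counting fact behind Sylow's theorem.\<close>

lemma prime_power_part_binomial:
  assumes "Factorial_Ring.prime (p::nat)" "N > 0"
  obtains k m where "N = p ^ k * m" "\<not> p dvd N choose p ^ k"
proof -
  obtain m where m: "N = p ^ multiplicity p N * m" "\<not> p dvd m"
    using multiplicity_decompose'[of N p] assms by (metis not_prime_unit neq0_conv)
  then have "m > 0" using assms(2) by (metis dvd_0_right neq0_conv)
  then have "multiplicity p (N choose p ^ multiplicity p N) = 0"
    using const_p_fac[OF _ assms(1), of m "multiplicity p N"] m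
    by (metis not_dvd_imp_multiplicity_0)
  moreover have "N choose p ^ multiplicity p N \<noteq> 0"
    using assms(2) dvd_imp_le[OF multiplicity_dvd[of p N]] by simp
  ultimately have "\<not> p dvd N choose p ^ multiplicity p N"
    using assms(1) by (metis multiplicity_eq_zero_iff not_prime_unit)
  then show ?thesis using that m(1) by blast
qed

context padic_complex_field
begin

lemma absv_mult_less_1: "absv a < 1 \<Longrightarrow> absv b \<le> 1 \<Longrightarrow> absv (a * b :: 'a) < 1"
  using mult_left_le[of "absv b" "absv a"] by (simp add: absv_mult)

text \<open>Divide a polynomial relation by the last of its coefficients of maximal absolute value and drop
  all terms behind that one.\<close>

lemma monic_residue_relation:
  assumes u: "u \<in> Qp_bar" "absv (u::'a) \<le> 1"
  obtains Q where "poly_over Qp Q" "lead_coeff Q = 1" "degree Q > 0"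
    "\<And>i. absv (coeff Q i) \<le> 1" "absv (poly Q u) < 1"
proof -
  obtain P where P: "poly_over Qp P" "P \<noteq> 0" "poly P u = 0" using u(1) Qp_bar_iff by blast
  define c where "c = Max ((\<lambda>i. absv (coeff P i)) ` {..degree P})"
  have le_c: "absv (coeff P i) \<le> c" for i
  proof (cases "i \<le> degree P")
    case False
    then have "absv (coeff P i) \<le> absv (coeff P 0)" by (simp add: coeff_eq_0)
    also have "\<dots> \<le> c" unfolding c_def by (intro Max_ge) auto
    finally show ?thesis .
  qed (auto simp: c_def)
  have "c > 0" using le_c[of "degree P"] P(2) absv_pos_iff[of "lead_coeff P"]
    by (metis leading_coeff_0_iff less_le_trans)
  have "c \<in> (\<lambda>i. absv (coeff P i)) ` {..degree P}" unfolding c_def by (intro Max_in) auto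
  then have ne: "{i. i \<le> degree P \<and> absv (coeff P i) = c} \<noteq> {}" by blast
  define d where "d = Max {i. i \<le> degree P \<and> absv (coeff P i) = c}"
  have d: "d \<le> degree P" "absv (coeff P d) = c"
    using Max_in[OF _ ne] by (auto simp: d_def)
  have gt_d: "absv (coeff P i) < c" if "i > d" for i
  proof (rule ccontr)
    assume "\<not> absv (coeff P i) < c"
    then have "absv (coeff P i) = c" using le_c[of i] by simp
    moreover from this have "i \<le> degree P" using \<open>c > 0\<close> by (metis absv_0 coeff_eq_0 less_irrefl not_le)
    ultimately have "i \<le> d" unfolding d_def by (intro Max_ge) auto
    then show False using that by simp
  qed
  define Q where "Q = smult (inverse (coeff P d)) (poly_cutoff (Suc d) P)"
  have coeff_Q: "coeff Q i = (if i \<le> d then coeff P i / coeff P d else 0)" for i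
    by (simp add: Q_def coeff_poly_cutoff divide_inverse mult.commute)
  have nz: "coeff P d \<noteq> 0" using d(2) \<open>c > 0\<close> by auto
  have "degree Q = d"
    using nz by (intro antisym degree_le le_degree) (auto simp: coeff_Q)
  have "lead_coeff Q = 1" using nz by (simp add: \<open>degree Q = d\<close> coeff_Q)
  have over: "poly_over Qp Q"
    using P(1) subfield_Cp_closed(1,8)[OF subfield_Qp] by (simp add: poly_over_def coeff_Q)
  have le1: "absv (coeff Q i) \<le> 1" for i
    using le_c[of i] \<open>c > 0\<close> by (simp add: coeff_Q absv_divide d(2))
  \<comment> \<open>As \<open>P\<close> vanishes at \<open>u\<close>, the value of \<open>Q\<close>
    is minus that of the dropped tail, whose normalised coefficients all have absolute value below
    1.\<close>
  have "poly Q u = - poly (smult (inverse (coeff P d)) P - Q) u" using P(3) by simp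
  also have "absv \<dots> < 1"
    unfolding absv_minus poly_altdef
  proof (rule absv_sum_less)
    fix i
    have "absv (coeff (smult (inverse (coeff P d)) P - Q) i) < 1"
    proof (cases "i \<le> d")
      case False
      then have "coeff (smult (inverse (coeff P d)) P - Q) i = coeff P i / coeff P d"
        by (simp add: coeff_Q divide_inverse mult.commute)
      then show ?thesis using gt_d[of i] False \<open>c > 0\<close> d(2) by (simp add: absv_divide)
    qed (simp add: coeff_Q divide_inverse mult.commute)
    then show "absv (coeff (smult (inverse (coeff P d)) P - Q) i * u ^ i) < 1"
      by (rule absv_mult_less_1[OF _ absv_power_le_1[OF u(2)]])
  qed auto
  finally have less1: "absv (poly Q u) < 1" .
  have "degree Q > 0"
  proof (rule ccontr)
    assume "\<not> degree Q > 0"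
    then obtain b where "Q = [:b:]" by (metis degree_eq_zeroE neq0_conv)
    then show False using less1 \<open>lead_coeff Q = 1\<close> by simp
  qed
  then show ?thesis using that over \<open>lead_coeff Q = 1\<close> le1 less1 by blast
qed

text \<open>Reduction of powers modulo the monic \<open>Q\<close>: multiply by \<open>u\<close>,
  then subtract the multiple of \<open>Q\<close> that cancels the top coefficient.\<close>

lemma power_cong_integral_combination:
  assumes u: "absv (u::'a) \<le> 1" and Q: "poly_over Qp Q" "lead_coeff Q = 1" "degree Q > 0"
    "\<And>i. absv (coeff Q i) \<le> 1" "absv (poly Q u) < 1"
  shows "\<exists>Z. poly_over Qp Z \<and> (\<forall>i. absv (coeff Z i) \<le> 1) \<and> degree Z < degree Q \<and>
    absv (u ^ k - poly Z u) < 1"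
proof (induction k)
  case 0
  show ?case
    by (rule exI[of _ 1])
      (use Q(3) subfield_Cp_closed(1,2)[OF subfield_Qp] in \<open>auto simp: poly_over_def coeff_1\<close>)
next
  case (Suc k)
  then obtain Z where Z: "poly_over Qp Z" "\<And>i. absv (coeff Z i) \<le> 1" "degree Z < degree Q"
    "absv (u ^ k - poly Z u) < 1" by blast
  \<comment> \<open>The coefficient of \<open>pCons 0 Z\<close> at \<open>degree Q\<close>, to be
    cancelled against the monic \<open>Q\<close>.\<close>
  define c where "c = coeff Z (degree Q - 1)"
  define Z' where "Z' = pCons 0 Z - smult c Q"
  have c: "c \<in> Qp" "absv c \<le> 1" using Z by (auto simp: c_def poly_over_def)
  have "poly_over Qp Z'"
    unfolding Z'_def using Z(1) Q(1) c(1) subfield_Cp_closed(1)[OF subfield_Qp]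
    by (intro poly_over_ops[OF subfield_Qp]) (auto simp: poly_over_pCons)
  moreover have "absv (coeff Z' i) \<le> 1" for i
  proof -
    have "absv (coeff (pCons 0 Z) i) \<le> 1" using Z(2) by (cases i) auto
    moreover have "absv (coeff (smult c Q) i) \<le> 1"
      using c(2) Q(4) by (simp add: absv_mult mult_le_one)
    ultimately show ?thesis
      unfolding Z'_def coeff_diff using absv_diff_le by (metis max.bounded_iff order.trans)
  qed
  moreover have "degree Z' < degree Q"
  proof -
    have "coeff Z' (degree Q) = 0"
      using Q(2,3) by (cases "degree Q") (auto simp: Z'_def c_def)
    moreover have "degree Z' \<le> degree Q"
      unfolding Z'_def using Z(3) by (intro degree_diff_le) (auto simp: degree_pCons_eq_if)
    ultimately show ?thesis
      using Q(3) by (metis degree_0 leading_coeff_0_iff order_le_imp_less_or_eq)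
  qed
  moreover have "absv (u ^ Suc k - poly Z' u) < 1"
  proof -
    have "u ^ Suc k - poly Z' u = u * (u ^ k - poly Z u) + c * poly Q u"
      by (simp add: Z'_def algebra_simps)
    moreover have "absv (u * (u ^ k - poly Z u)) < 1" "absv (c * poly Q u) < 1"
      using absv_mult_less_1[OF Z(4) u] absv_mult_less_1[OF Q(5) c(2)] by (simp_all add: mult.commute)
    ultimately show ?thesis
      using absv_add_le[of "u * (u ^ k - poly Z u)" "c * poly Q u"] by simp
  qed
  ultimately show ?case by blast
qed

text \<open>Powers of \<open>u\<close> have only finitely many residues, so two of the powers
  \<open>u ^ (p ^ i)\<close> are congruent, and injectivity of Frobenius strips off the smaller
  exponent.\<close>

lemma periodic_residue:
  assumes u: "u \<in> Qp_bar" "absv (u::'a) \<le> 1"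
  obtains j where "j > 0" "absv (u ^ (p ^ j) - u) < 1"
proof -
  obtain Q where Q: "poly_over Qp Q" "lead_coeff Q = 1" "degree Q > 0"
    "\<And>i. absv (coeff Q i) \<le> 1" "absv (poly Q u) < 1"
    using monic_residue_relation[OF u] by blast
  \<comment> \<open>Combinations with digits below \<open>p\<close> represent the residues of all
    powers of \<open>u\<close>; using extensional digit functions keeps the index set
    finite.\<close>
  define G where "G = (\<lambda>a. \<Sum>i<degree Q. of_nat (a i) * u ^ i) ` ({..<degree Q} \<rightarrow>\<^sub>E {..<p})"
  have "finite G" unfolding G_def by (intro finite_imageI finite_PiE) auto
  have "\<exists>g\<in>G. absv (u ^ k - g) < 1" for k
  proof -
    obtain Z where Z: "poly_over Qp Z" "\<And>i. absv (coeff Z i) \<le> 1" "degree Z < degree Q"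
      "absv (u ^ k - poly Z u) < 1"
      using power_cong_integral_combination[OF u(2) Q] by blast
    have "\<forall>i. \<exists>a<p. absv (coeff Z i - of_nat a) < 1"
      using digit_exists Z(1,2) unfolding poly_over_def by blast
    then obtain a where a: "\<And>i. a i < p" "\<And>i. absv (coeff Z i - of_nat (a i)) < 1" by metis
    define g where "g = (\<Sum>i<degree Q. of_nat (a i) * u ^ i)"
    have "g = (\<Sum>i<degree Q. of_nat (restrict a {..<degree Q} i) * u ^ i)"
      by (simp add: g_def)
    moreover have "restrict a {..<degree Q} \<in> {..<degree Q} \<rightarrow>\<^sub>E {..<p}" using a(1) by auto
    ultimately have "g \<in> G" unfolding G_def by blast
    have "poly Z u = (\<Sum>i<degree Q. coeff Z i * u ^ i)"
      unfolding poly_altdef by (rule sum.mono_neutral_left) (use Z(3) in \<open>auto simp: coeff_eq_0\<close>)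
    then have "poly Z u - g = (\<Sum>i<degree Q. (coeff Z i - of_nat (a i)) * u ^ i)"
      by (simp add: g_def sum_subtractf algebra_simps)
    also have "absv \<dots> < 1"
    proof (rule absv_sum_less)
      fix i
      show "absv ((coeff Z i - of_nat (a i)) * u ^ i) < 1"
        by (rule absv_mult_less_1[OF a(2) absv_power_le_1[OF u(2)]])
    qed auto
    finally show ?thesis using cong_trans[OF Z(4)] \<open>g \<in> G\<close> by blast
  qed
  then obtain f where f: "\<And>k. f k \<in> G" "\<And>k. absv (u ^ k - f k) < 1" by metis
  have "\<not> inj_on (\<lambda>i. f (p ^ i)) UNIV"
    using f(1) \<open>finite G\<close> by (metis finite_imageD finite_subset image_subsetI infinite_UNIV_nat)
  then obtain i j where "f (p ^ i) = f (p ^ j)" "i < j"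
    unfolding inj_on_def by (metis linorder_neqE_nat)
  then have "absv (u ^ (p ^ j) - u ^ (p ^ i)) < 1"
    using f(2) cong_trans cong_sym by metis
  moreover have "p ^ j = p ^ (j - i) * p ^ i" using \<open>i < j\<close> by (simp flip: power_add)
  ultimately have "absv ((u ^ (p ^ (j - i))) ^ (p ^ i) - u ^ (p ^ i)) < 1"
    by (simp only: power_mult)
  then have "absv (u ^ (p ^ (j - i)) - u) < 1"
    using frobenius_power_cong_imp_cong absv_power_le_1 u(2) by blast
  then show ?thesis using that[of "j - i"] \<open>i < j\<close> by simp
qed

lemma periodic_residue_iterate:
  assumes "absv (u ^ (p ^ j) - u) < 1" "absv (u::'a) \<le> 1"
  shows "absv (u ^ (p ^ (j * m)) - u) < 1"
proof (induction m)
  case (Suc m)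
  have "absv ((u ^ (p ^ (j * m))) ^ (p ^ j) - u ^ (p ^ j)) < 1"
    using Suc assms(2) by (intro cong_power absv_power_le_1)
  then have "absv (u ^ (p ^ (j * Suc m)) - u ^ (p ^ j)) < 1"
    by (simp add: power_add mult.commute flip: power_mult)
  then show ?case using cong_trans assms(1) by blast
qed simp

section \<open>Residues fixed by the Galois group\<close>

lemma coeff_prod_linear_cong:
  assumes "absv (u::'a) \<le> 1" "\<And>r. r \<in> set rs \<Longrightarrow> absv (r - u) < 1"
  shows "absv (coeff (\<Prod>r\<leftarrow>rs. [:- r, 1:]) i) \<le> 1 \<and>
    absv (coeff (\<Prod>r\<leftarrow>rs. [:- r, 1:]) i - coeff ([:- u, 1:] ^ length rs) i) < 1"
  using assms(2)
proof (induction rs arbitrary: i)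
  case Nil
  then show ?case by (auto simp: coeff_1)
next
  case (Cons r rs)
  define P where "P = (\<Prod>r\<leftarrow>rs. [:- r, 1:])"
  define R where "R = [:- u, 1:] ^ length rs"
  have IH: "absv (coeff P i) \<le> 1" "absv (coeff P i - coeff R i) < 1" for i
    using Cons.IH Cons.prems by (simp_all add: P_def R_def)
  have IH': "absv (coeff (pCons 0 P) i) \<le> 1" "absv (coeff (pCons 0 P) i - coeff (pCons 0 R) i) < 1" for i
    using IH by (cases i; simp)+
  have r: "absv (r - u) < 1" using Cons.prems by simp
  then have r1: "absv r \<le> 1" using absv_add_le[of "r - u" u] assms(1) by simp
  have R1: "absv (coeff R i) \<le> 1" for i
    using absv_diff_le[of "coeff P i" "coeff P i - coeff R i"] IH[of i] by simp
  have "absv ((- r) * coeff P i - (- u) * coeff R i) < 1"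
    using r r1 IH R1 by (intro cong_mult) (simp_all add: absv_minus_commute)
  then have "absv ((- r * coeff P i + coeff (pCons 0 P) i) - (- u * coeff R i + coeff (pCons 0 R) i)) < 1"
    using IH'(2) by (rule cong_add)
  moreover have "absv (- r * coeff P i + coeff (pCons 0 P) i) \<le> 1"
  proof (rule order.trans[OF absv_add_le])
    have "absv (- r * coeff P i) \<le> 1" using r1 IH(1) by (simp add: absv_mult mult_le_one)
    then show "max (absv (- r * coeff P i)) (absv (coeff (pCons 0 P) i)) \<le> 1" using IH'(1) by simp
  qed
  ultimately show ?case
    by (simp add: P_def[symmetric] R_def[symmetric])
qed

end

context padic_subfield
begin

lemma minimal_polynomial:
  assumes "x \<in> Qp_bar"
  obtains P where "poly_over E P" "lead_coeff P = 1" "poly P x = 0"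
    "\<And>Q. poly_over E Q \<Longrightarrow> Q \<noteq> 0 \<Longrightarrow> poly Q x = 0 \<Longrightarrow> degree P \<le> degree Q"
proof -
  define ann where "ann P \<longleftrightarrow> poly_over E P \<and> P \<noteq> 0 \<and> poly P x = 0" for P
  obtain P where P: "is_arg_min degree ann P"
    using alg[OF assms] is_arg_min_arg_min_nat[of ann] unfolding ann_def by blast
  define P' where "P' = smult (inverse (lead_coeff P)) P"
  have "P \<noteq> 0" "poly_over E P" "poly P x = 0" using P by (auto simp: is_arg_min_linorder ann_def)
  then have "poly_over E P'" "lead_coeff P' = 1" "poly P' x = 0"
    using poly_over_ops(3)[OF sub_E] E_closed(7)
    unfolding P'_def poly_over_def by (simp_all del: coeff_smult lead_coeff_smult, auto)
  moreover have "degree P' = degree P" using \<open>P \<noteq> 0\<close> by (simp add: P'_def)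
  ultimately show ?thesis using that[of P'] P by (auto simp: is_arg_min_linorder ann_def)
qed

text \<open>The minimal polynomial of such a \<open>u\<close> is \<open>(X - u)\<^sup>N\<close> modulo the maximal ideal; its coefficient
  with index \<open>N - q\<close>, where \<open>q\<close> is the exact power of \<open>p\<close> dividing \<open>N\<close>, puts \<open>u\<^sup>q\<close> into the residue
  field of \<open>E\<close>, which is perfect.\<close>

lemma Galois_fixed_residue:
  assumes u: "u \<in> Qp_bar" "absv u \<le> 1" and fixed: "\<And>\<sigma>. \<sigma> \<in> Gal E \<Longrightarrow> absv (\<sigma> u - u) < 1"
  shows "\<exists>c\<in>E. absv (u - c) < 1"
proof -
  obtain P where P: "poly_over E P" "lead_coeff P = 1" "poly P u = 0"
    and minimal: "\<And>Q. poly_over E Q \<Longrightarrow> Q \<noteq> 0 \<Longrightarrow> poly Q u = 0 \<Longrightarrow> degree P \<le> degree Q"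
    using minimal_polynomial[OF u(1)] by blast
  have "P \<noteq> 0" using P(2) by auto
  obtain rs where rs: "set rs \<subseteq> Qp_bar" "P = (\<Prod>r\<leftarrow>rs. [:- r, 1:])"
    using splits[OF poly_over_mono[OF E_subset P(1)] \<open>P \<noteq> 0\<close>] P(2) by auto
  define N where "N = length rs"
  have "N > 0" using P(3) rs(2) by (auto simp: N_def)
  \<comment> \<open>The roots of the minimal polynomial are conjugates of \<open>u\<close>, hence
    congruent to it by assumption.\<close>
  have "absv (r - u) < 1" if r: "r \<in> set rs" for r
  proof -
    have "poly P r = 0"
      using r unfolding rs(2) poly_prod_list_linear by (auto simp: prod_list_zero_iff)
    moreover have "r \<in> Qp_bar" using r rs(1) by blast
    ultimately have "\<exists>\<sigma>\<in>Gal E. \<sigma> u = r"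
      using P(1,3) \<open>P \<noteq> 0\<close> u(1) by (intro Gal_exists[of P]) (auto intro: minimal)
    then show ?thesis using fixed by blast
  qed
  then have cong: "absv (coeff P i - coeff ([:- u, 1:] ^ N) i) < 1" for i
    unfolding rs(2) N_def using coeff_prod_linear_cong[OF u(2)] by blast
  obtain k m where km: "N = p ^ k * m" "\<not> p dvd N choose p ^ k"
    using prime_power_part_binomial[OF prime_p \<open>N > 0\<close>] .
  define q where "q = p ^ k"
  have "q \<le> N" using km(1) \<open>N > 0\<close> by (simp add: q_def)
  \<comment> \<open>The coefficient of \<open>(X - u) ^ N\<close> at \<open>N - q\<close> is
    \<open>b * u ^ q\<close>; the choice of \<open>q\<close> makes \<open>b\<close> a unit.\<close>
  define b where "b = of_nat (N choose q) * (- 1 :: 'a) ^ q"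
  have "absv b = 1"
    using absv_of_nat_eq_1[OF km(2)] by (simp add: b_def q_def absv_mult absv_power)
  have "b \<in> E" unfolding b_def by (intro E_closed)
  have "coeff ([:- u, 1:] ^ N) (N - q) = of_nat (N choose (N - q)) * (- u) ^ q"
    using coeff_linear_poly_power[of "N - q" N "- u" 1] \<open>q \<le> N\<close> by simp
  also have "\<dots> = b * u ^ q"
    using \<open>q \<le> N\<close> by (simp add: b_def binomial_symmetric[symmetric] power_minus[of u])
  finally have *: "absv (coeff P (N - q) - b * u ^ q) < 1" using cong[of "N - q"] by simp
  define g where "g = coeff P (N - q) / b"
  have "g \<in> E" unfolding g_def using P(1) \<open>b \<in> E\<close> E_closed(8) by (simp add: poly_over_def)
  have "b \<noteq> 0" using \<open>absv b = 1\<close> by auto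
  then have "g - u ^ q = (coeff P (N - q) - b * u ^ q) / b" by (simp add: g_def field_simps)
  then have g: "absv (g - u ^ q) < 1" using * \<open>absv b = 1\<close> by (simp add: absv_divide)
  have g1: "absv g \<le> 1"
    using absv_add_le[of "g - u ^ q" "u ^ q"] g absv_power_le_1[OF u(2), of q] by simp
  obtain j where j: "j > 0" "absv (u ^ (p ^ j) - u) < 1"
    using periodic_residue[OF u] .
  \<comment> \<open>As \<open>g\<close> is congruent to \<open>u ^ q\<close> with
    \<open>q = p ^ k\<close>, this power is congruent to \<open>u ^ (p ^ (j * k))\<close> and so to
    \<open>u\<close>; positivity of \<open>j\<close> makes the subtraction in the exponent
    exact.\<close>
  define c where "c = g ^ (p ^ (j * k - k))"
  have "p ^ (j * k) = q * p ^ (j * k - k)"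
    using j(1) by (simp add: q_def flip: power_add)
  then have "absv (c - u ^ (p ^ (j * k))) < 1"
    unfolding c_def using cong_power[OF g g1 absv_power_le_1[OF u(2)]] by (simp add: power_mult)
  then have "absv (c - u) < 1"
    using periodic_residue_iterate[OF j(2) u(2), of k] cong_trans by blast
  moreover have "c \<in> E" unfolding c_def using \<open>g \<in> E\<close> E_closed(9) by blast
  ultimately show ?thesis using cong_sym by blast
qed

end

section \<open>Degrees of elements and dimensions of extensions\<close>

lemma irr_polynomial:
  assumes K: "subfield K (Cp_ring :: 'a::field ring)" and x: "(ring.algebraic Cp_ring over K) x"
  shows "\<exists>P. poly_over K P \<and> P \<noteq> 0 \<and> poly P x = 0 \<and>
      degree P = Polynomials.degree (ring.Irr Cp_ring K x)"
    and "poly_over K Q \<Longrightarrow> Q \<noteq> 0 \<Longrightarrow> poly Q x = 0 \<Longrightarrow>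
      Polynomials.degree (ring.Irr Cp_ring K x) \<le> degree Q"
proof -
  define q where "q = ring.Irr Cp_ring K x"
  have q: "q \<in> carrier (univ_poly Cp_ring K)" "Polynomials.lead_coeff q = 1" "ring.eval Cp_ring q x = 0"
    using Cp.IrrE[OF K _ x] by (simp_all add: q_def)
  have "q \<noteq> []" using Cp.IrrE(2)[OF K _ x] Cp.pirreducibleE(1)[OF subfieldE(1)[OF K]] q(1)
    by (auto simp: q_def)
  have sub: "set q \<subseteq> K" using q(1) by (auto simp: Cp_univ_poly_iff[OF K])
  define P where "P = Poly (rev q)"
  have coeff_P: "coeff P i = nth_default 0 (rev q) i" for i by (simp add: P_def)
  have "poly_over K P"
    using sub subfield_Cp_closed(1)[OF K]
    by (auto simp: poly_over_def coeff_P nth_default_def) (metis in_mono length_rev nth_mem set_rev)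
  moreover have lead: "coeff P (length q - 1) = 1"
    using q(2) \<open>q \<noteq> []\<close> by (cases q) (auto simp: coeff_P nth_default_def nth_append)
  moreover have "degree P \<le> length q - 1"
    by (rule degree_le) (auto simp: coeff_P nth_default_def)
  then have "degree P = length q - 1" using lead by (intro antisym le_degree) auto
  moreover have "poly P x = 0" using q(3) by (simp add: P_def eval_Cp)
  ultimately show "\<exists>P. poly_over K P \<and> P \<noteq> 0 \<and> poly P x = 0 \<and>
      degree P = Polynomials.degree (ring.Irr Cp_ring K x)"
    by (intro exI[of _ P]) (auto simp: q_def)
  assume Q: "poly_over K Q" "Q \<noteq> 0" "poly Q x = 0"
  note Ql = Cp_list_of_poly[OF K Q(1)]
  have "q pdivides\<^bsub>Cp_ring\<^esub> rev (coeffs Q)"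
    unfolding q_def by (rule Cp.Irr_minimal[OF K _ x Ql]) (use Q in \<open>auto simp: eval_Cp\<close>)
  then have "Polynomials.degree q \<le> Polynomials.degree (rev (coeffs Q))"
    using Cp.pdivides_imp_degree_le[OF subfieldE(1)[OF K] q(1) Ql] Q(2) by simp
  then show "Polynomials.degree (ring.Irr Cp_ring K x) \<le> degree Q"
    using Q(2) by (simp add: q_def degree_eq_length_coeffs)
qed

text \<open>The powers of \<open>x\<close> below its degree are independent over \<open>K\<close>,
  so the dimension of \<open>L\<close> bounds all degrees.\<close>

lemma finite_dimension_bounded_degree:
  assumes K: "subfield K (Cp_ring :: 'a::field ring)" and L: "subfield L Cp_ring"
    and dim: "ring.finite_dimension Cp_ring K L"
  shows "\<exists>N. \<forall>x\<in>L. \<exists>P. poly_over K P \<and> P \<noteq> 0 \<and> poly P x = 0 \<and> degree P \<le> N"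
proof -
  obtain N where N: "Cp.dimension N K L" using Cp.finite_dimensionE'[OF dim] by blast
  have "\<exists>P. poly_over K P \<and> P \<noteq> 0 \<and> poly P x = 0 \<and> degree P \<le> N" if x: "x \<in> L" for x
  proof -
    have alg: "(ring.algebraic Cp_ring over K) x"
      using Cp.finite_dimension_imp_algebraic[OF K subfieldE(1)[OF L] dim x] .
    have "x [^]\<^bsub>Cp_ring\<^esub> (i::nat) = x ^ i" for i by (induction i) auto
    then have "set (Cp.exp_base x (Polynomials.degree (Cp.Irr K x))) \<subseteq> L"
      using subfield_Cp_closed(9)[OF L x] by (auto simp: Cp.exp_base_def)
    then have "length (Cp.exp_base x (Polynomials.degree (Cp.Irr K x))) \<le> N"
      by (intro Cp.independent_length_le_dimension[OF K N] Cp.exp_base_independent[OF K _ alg]) auto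
    then have "Polynomials.degree (Cp.Irr K x) \<le> N" by (simp add: Cp.exp_base_def)
    then show ?thesis using irr_polynomial(1)[OF K alg] by metis
  qed
  then show ?thesis by blast
qed

section \<open>Value classes\<close>

context padic_subfield
begin

text \<open>For nonzero \<open>x\<close>, the coset of the value group of \<open>E\<close> that
  contains \<open>absv x\<close>.\<close>

definition value_class :: "'a \<Rightarrow> real set"
  where "value_class x = {absv (c * x) |c. c \<in> E - {0}}"

lemma value_class_eq_iff: "value_class x = value_class y \<longleftrightarrow> (\<exists>c\<in>E-{0}. absv x = absv (c * y))"
proof
  assume eq: "value_class x = value_class y"
  have "absv x = absv (1 * x)" "1 \<in> E - {0}" using E_closed(2) by auto
  then have "absv x \<in> value_class x" unfolding value_class_def by blast
  then show "\<exists>c\<in>E-{0}. absv x = absv (c * y)" unfolding eq by (auto simp: value_class_def)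
next
  assume "\<exists>c\<in>E-{0}. absv x = absv (c * y)"
  then obtain c where c: "c \<in> E" "c \<noteq> 0" "absv x = absv (c * y)" by blast
  have "absv (d * x) = absv ((d * c) * y)" "absv (d * y) = absv ((d / c) * x)" for d
    using c(2,3) by (simp_all add: absv_mult absv_divide)
  moreover have "d * c \<in> E - {0}" "d / c \<in> E - {0}" if "d \<in> E - {0}" for d
    using E_closed(6,8) c(1,2) that by auto
  ultimately show "value_class x = value_class y" unfolding value_class_def by blast
qed

lemma value_class_cong: "absv x = absv y \<Longrightarrow> value_class x = value_class y"
  by (simp add: value_class_def absv_mult)

lemma rcosets_value_group:
  "rcosets\<^bsub>value_group F\<^esub> (carrier (value_group E)) = value_class ` (F - {0})"
  unfolding RCOSETS_def r_coset_def value_group_def value_class_def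
  by (auto simp: absv_mult image_iff)

text \<open>Summands in distinct classes have distinct absolute values, so the larger one determines
  the value of the sum. Both claims share one induction: the second keeps \<open>u\<close>, whose
  class is new, outside the span of the rest.\<close>

lemma value_class_independent:
  assumes "0 \<notin> set bs" "distinct (map value_class bs)"
  shows "ring.independent Cp_ring E bs \<and>
    (\<forall>v\<in>ring.Span Cp_ring E bs - {0}. \<exists>b\<in>set bs. value_class v = value_class b)"
  using assms
proof (induction bs)
  case (Cons u bs)
  have ind: "ring.independent Cp_ring E bs"
    and cls: "\<And>v. v \<in> ring.Span Cp_ring E bs \<Longrightarrow> v \<noteq> 0 \<Longrightarrow> \<exists>b\<in>set bs. value_class v = value_class b"
    using Cons by auto
  have u: "u \<noteq> 0" "value_class u \<notin> value_class ` set bs" using Cons.prems by auto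
  have "u \<notin> ring.Span Cp_ring E bs" using cls[of u] u by auto
  then have "ring.independent Cp_ring E (u # bs)" using ind by (intro Cp.li_Cons) auto
  moreover have "\<exists>b\<in>set (u # bs). value_class v = value_class b"
    if v: "v \<in> ring.Span Cp_ring E (u # bs)" "v \<noteq> 0" for v
  proof -
    obtain c w where cw: "c \<in> E" "w \<in> ring.Span Cp_ring E bs" "v = c * u + w"
      using v(1) unfolding Span_Cp_Cons by blast
    consider "c = 0" | "c \<noteq> 0" "w = 0" | "c \<noteq> 0" "w \<noteq> 0" by blast
    then show ?thesis
    proof cases
      case 1
      then show ?thesis using cls[OF cw(2)] v(2) cw(3) by auto
    next
      case 2
      then have "value_class v = value_class u" using cw by (auto simp: value_class_eq_iff)
      then show ?thesis by simp
    next
      case 3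
      then obtain b where b: "b \<in> set bs" "value_class w = value_class b" using cls[OF cw(2)] by blast
      have cu: "value_class (c * u) = value_class u"
        using 3 cw(1) by (auto simp: value_class_eq_iff)
      have "absv (c * u) \<noteq> absv w"
      proof
        assume "absv (c * u) = absv w"
        then have "value_class (c * u) = value_class w" by (rule value_class_cong)
        then show False using cu b u(2) by auto
      qed
      then have "absv v = absv (c * u) \<or> absv v = absv w"
        using absv_add_eq[of w "c * u"] absv_add_eq[of "c * u" w] cw(3)
        by (metis add.commute linorder_neqE_linordered_idom)
      then have "value_class v = value_class u \<or> value_class v = value_class b"
        using cu b(2) value_class_cong by metis
      then show ?thesis using b(1) by auto
    qed
  qed
  ultimately show ?case by blast
qed auto

lemma value_class_representatives:
  assumes "finite (value_class ` S)"
  obtains bs where "set bs \<subseteq> S" "distinct (map value_class bs)" "value_class ` set bs = value_class ` S"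
    "length bs = card (value_class ` S)"
proof -
  obtain cs where cs: "set cs = value_class ` S" "distinct cs"
    using finite_distinct_list[OF assms] by blast
  define rep where "rep = inv_into S value_class"
  have rep: "rep c \<in> S" "value_class (rep c) = c" if "c \<in> set cs" for c
    using that by (auto simp: rep_def cs(1) inv_into_into f_inv_into_f)
  have "map value_class (map rep cs) = cs" using rep(2) by (simp add: map_idI)
  then have *: "distinct (map value_class (map rep cs))"
    "value_class ` set (map rep cs) = value_class ` S" "length (map rep cs) = card (value_class ` S)"
    using cs by (simp_all add: distinct_card[symmetric] image_image del: map_map flip: set_map)
  show ?thesis by (rule that[of "map rep cs"]) (use * rep(1) in auto)
qed

text \<open>Representatives of distinct cosets are linearly independent over
  \<open>E\<close>.\<close>

lemma ramification_index_le_degree: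
  assumes "finite_field_ext E F"
  shows "finite (value_class ` (F - {0}))" "ramification_index E F \<le> ext_degree E F"
    "ramification_index E F = card (value_class ` (F - {0}))"
proof -
  have dim: "Cp.dimension (ext_degree E F) E F"
    using Cp.finite_dimensionE[OF sub_E] assms by (simp add: finite_field_ext_def over_def)
  \<comment> \<open>Finite sets of classes are bounded first: \<open>card\<close> is 0 on infinite
    sets, and finiteness of the set of all classes is deduced from this uniform bound.\<close>
  have "card T \<le> ext_degree E F" if T: "T \<subseteq> value_class ` (F - {0})" "finite T" for T
  proof -
    obtain S where S: "S \<subseteq> F - {0}" "T = value_class ` S" using T(1) by (auto simp: subset_image_iff)
    obtain bs where bs: "set bs \<subseteq> S" "distinct (map value_class bs)" "length bs = card T"
      using value_class_representatives[of S] T(2) S(2) by metis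
    then have "Cp.independent E bs" using value_class_independent[of bs] S(1) by blast
    then show ?thesis
      using Cp.independent_length_le_dimension[OF sub_E dim, of bs] bs S(1) by auto
  qed
  then have "finite (value_class ` (F - {0})) \<and> card (value_class ` (F - {0})) \<le> ext_degree E F"
    by (intro finite_if_finite_subsets_card_bdd) auto
  then show "finite (value_class ` (F - {0}))" "ramification_index E F \<le> ext_degree E F"
    "ramification_index E F = card (value_class ` (F - {0}))"
    by (simp_all add: ramification_index_def rcosets_value_group)
qed

end

section \<open>Derivatives, Taylor coefficients and distances of roots\<close>

lemma power_less_prod_list:
  fixes \<rho> :: real
  assumes "\<rho> \<ge> 0" "xs \<noteq> []" "\<And>x. x \<in> set xs \<Longrightarrow> \<rho> < f x"
  shows "\<rho> ^ length xs < (\<Prod>x\<leftarrow>xs. f x)"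
  using assms(2,3)
proof (induction xs rule: list_nonempty_induct)
  case (cons x xs)
  then have "\<rho> < f x" "\<rho> ^ length xs < (\<Prod>x\<leftarrow>xs. f x)" by auto
  then show ?case using assms(1) by (auto intro!: mult_strict_mono)
qed simp

lemma higher_pderiv_shift:
  "(pderiv ^^ k) (pcompose P [:a, 1 :: 'a::field_char_0:]) = pcompose ((pderiv ^^ k) P) [:a, 1:]"
  by (induction k) (simp_all add: pderiv_pcompose pderiv_pCons)

lemma poly_higher_pderiv:
  "poly ((pderiv ^^ k) P) (a :: 'a::field_char_0) = fact k * coeff (pcompose P [:a, 1:]) k"
proof -
  have "poly ((pderiv ^^ k) P) a = poly ((pderiv ^^ k) (pcompose P [:a, 1:])) 0"
    by (simp add: higher_pderiv_shift poly_pcompose)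
  also have "\<dots> = fact k * coeff (pcompose P [:a, 1:]) k"
    by (simp add: poly_0_coeff_0 coeff_higher_pderiv pochhammer_fact)
  finally show ?thesis .
qed

text \<open>Coefficients of iterated derivatives come as Pochhammer symbols; this form separates
  \<open>fact k\<close>, which later cancels, from a binomial coefficient that can be prime to
  \<open>p\<close>.\<close>

lemma pochhammer_Suc_eq_fact_binomial:
  "pochhammer (of_nat (Suc m)) k = (fact k * of_nat ((m + k) choose k) :: 'a::field_char_0)"
proof -
  have "pochhammer (of_nat (Suc m)) k * fact m = (fact (m + k) :: 'a)"
  proof (induction k)
    case (Suc k)
    have "pochhammer (of_nat (Suc m)) (Suc k) * fact m =
        of_nat (m + Suc k) * (pochhammer (of_nat (Suc m)) k * fact m :: 'a)"
      by (simp add: pochhammer_rec' ac_simps)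
    then show ?case unfolding Suc by (simp add: ac_simps)
  qed simp
  also have "\<dots> = fact k * of_nat ((m + k) choose k) * fact m"
    by (simp add: binomial_fact)
  finally show ?thesis by simp
qed

context padic_complex_field
begin

text \<open>Distances are compared only with those of points of \<open>D\<close>, which treats open
  and closed disks alike: by the ultrametric inequality \<open>y\<close> is at most as far from the
  centre as one of \<open>x\<close> and \<open>z\<close>.\<close>

lemma disk_mem_if_dist_le:
  assumes "disk (D :: 'a set)" "x \<in> D" "z \<in> D" "absv (y - x) \<le> absv (z - x)"
  shows "y \<in> D"
proof -
  obtain a r where D: "D = cball a r \<or> D = ball a r" using assms(1) by (auto simp: disk_def)
  have "absv (a - y) \<le> max (absv (a - x)) (absv (y - x))"
    using absv_diff_le[of "a - x" "y - x"] by simp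
  moreover have "absv (z - x) \<le> max (absv (a - x)) (absv (a - z))"
    using absv_diff_le[of "a - x" "a - z"] by simp
  ultimately have "absv (a - y) \<le> max (absv (a - x)) (absv (a - z))" using assms(4) by linarith
  then show ?thesis using D assms(2,3) by (auto simp: dist_eq_absv)
qed

text \<open>After the shift, the coefficient with index \<open>i\<close> is the elementary symmetric
  polynomial of degree \<open>length rs - i\<close> in the numbers \<open>a - r\<close>.\<close>

lemma coeff_prod_linear_le:
  assumes "\<rho> \<ge> 0" "\<And>r. r \<in> set rs \<Longrightarrow> absv (a - r :: 'a) \<le> \<rho>" "i \<le> length rs"
  shows "absv (coeff (pcompose (\<Prod>r\<leftarrow>rs. [:- r, 1:]) [:a, 1:]) i) \<le> \<rho> ^ (length rs - i)"
  using assms(2,3)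
proof (induction rs arbitrary: i)
  case Nil
  then show ?case by simp
next
  case (Cons r rs)
  define P where "P = pcompose (\<Prod>r\<leftarrow>rs. [:- r, 1:]) [:a, 1:]"
  have IH: "absv (coeff P i) \<le> \<rho> ^ (length rs - i)" if "i \<le> length rs" for i
    using Cons.IH Cons.prems(1) that by (simp add: P_def)
  have deg: "degree P = length rs" by (simp add: P_def degree_prod_list_linear degree_pcompose)
  have r: "absv (a - r) \<le> \<rho>" using Cons.prems(1) by simp
  have "pcompose (\<Prod>r\<leftarrow>r # rs. [:- r, 1:]) [:a, 1:] = [:a - r, 1:] * P"
    by (simp only: list.map prod_list.Cons pcompose_mult P_def) (simp add: pcompose_pCons)
  then have eq: "coeff (pcompose (\<Prod>r\<leftarrow>r # rs. [:- r, 1:]) [:a, 1:]) i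
      = (a - r) * coeff P i + coeff (pCons 0 P) i" by simp
  have "absv ((a - r) * coeff P i) \<le> \<rho> ^ (length (r # rs) - i)"
  proof (cases "i \<le> length rs")
    case True
    then have "\<rho> ^ (length (r # rs) - i) = \<rho> * \<rho> ^ (length rs - i)" by (simp add: Suc_diff_le)
    then show ?thesis using mult_mono[OF r IH[OF True] assms(1)] by (simp add: absv_mult)
  next
    case False
    then show ?thesis using assms(1) deg by (simp add: coeff_eq_0)
  qed
  moreover have "absv (coeff (pCons 0 P) i) \<le> \<rho> ^ (length (r # rs) - i)"
    using IH Cons.prems(2) assms(1) by (cases i) auto
  ultimately show ?case
    unfolding eq using absv_add_le by (meson max.bounded_iff order.trans)
qed

end

section \<open>Disks defined over a finite extension\<close>

locale padic_disk = padic_subfield p E for p and E :: "'a::{field_char_0, complete_space} set" +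
  fixes D :: "'a set"
  assumes finite_E: "ring.finite_dimension Cp_ring Qp E"
    and disk_D: "disk D" and D_over_E: "defined_over E D"
begin

lemmas D_mem = disk_mem_if_dist_le[OF disk_D]

lemma closed_E: "closed E"
proof -
  obtain N where "Cp.dimension N Qp E" using Cp.finite_dimensionE'[OF finite_E] by blast
  then obtain Us where "ring.Span Cp_ring Qp Us = E"
    using Cp.exists_base[OF subfield_Qp] by blast
  then show ?thesis using closed_Span[OF subfield_Qp closed_Qp, of Us] by simp
qed

section \<open>The least degree of a polynomial with a root in the disk\<close>

lemma root_in_Qp_bar:
  assumes "poly_over Qp_bar P" "P \<noteq> 0" "poly P (x::'a) = 0"
  shows "x \<in> Qp_bar"
proof -
  obtain rs where rs: "set rs \<subseteq> Qp_bar" "P = smult (lead_coeff P) (\<Prod>r\<leftarrow>rs. [:- r, 1:])"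
    using splits[OF assms(1,2)] by blast
  have "(\<Prod>r\<leftarrow>rs. x - r) = 0"
    using assms(2,3) arg_cong[OF rs(2), of "\<lambda>P. poly P x"] by (simp add: poly_prod_list_linear)
  then show ?thesis using rs(1) by (auto simp: prod_list_zero_iff)
qed

definition rooted_degree :: nat
  where "rooted_degree = (LEAST n. \<exists>P x. poly_over E P \<and> P \<noteq> 0 \<and> x \<in> D \<and> poly P x = 0 \<and> degree P = n)"

lemma rooted_degree_le:
  assumes "poly_over E P" "P \<noteq> 0" "x \<in> D" "poly P x = 0"
  shows "rooted_degree \<le> degree P"
  unfolding rooted_degree_def by (rule Least_le) (use assms in blast)

lemma D_meets_Qp_bar: "\<exists>x\<in>Qp_bar. x \<in> D"
proof -
  obtain a r where ar: "r > 0" "D = cball a r \<or> D = ball a r" using disk_D by (auto simp: disk_def)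
  have "a \<in> closure Qp_bar" using Qp_bar_dense by simp
  then obtain x where "x \<in> Qp_bar" "dist x a < r" using ar(1) by (auto simp: closure_approachable)
  then show ?thesis using ar(2) by (auto simp: dist_commute intro: less_imp_le)
qed

lemma rooted_degree_attained:
  obtains P x where "poly_over E P" "lead_coeff P = 1" "x \<in> D" "x \<in> Qp_bar" "poly P x = 0"
    "degree P = rooted_degree"
proof -
  obtain x0 P0 where "x0 \<in> D" "poly_over E P0" "P0 \<noteq> 0" "poly P0 x0 = 0"
    using D_meets_Qp_bar alg by blast
  then have "\<exists>n P x. poly_over E P \<and> P \<noteq> 0 \<and> x \<in> D \<and> poly P x = 0 \<and> degree P = n" by blast
  from LeastI_ex[OF this, folded rooted_degree_def]
  obtain Q x where Q: "poly_over E Q" "Q \<noteq> 0" "x \<in> D" "poly Q x = 0" "degree Q = rooted_degree"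
    by blast
  have x: "x \<in> Qp_bar" using root_in_Qp_bar[OF poly_over_mono[OF E_subset Q(1)] Q(2,4)] .
  obtain P where P: "poly_over E P" "lead_coeff P = 1" "poly P x = 0" "degree P \<le> degree Q"
    using minimal_polynomial[OF x] Q by metis
  have "P \<noteq> 0" using P(2) by auto
  then have "degree P = rooted_degree" using rooted_degree_le[OF P(1) _ Q(3) P(3)] P(4) Q(5) by simp
  then show ?thesis using that P Q(3) x by blast
qed

text \<open>Let \<open>A\<close> be the \<open>q\<close>-th derivative of \<open>P\<close> and
  \<open>\<rho>\<close> the largest distance from \<open>x\<close> to a root of \<open>P\<close>.
  Taylor expansion of \<open>P\<close> at \<open>x\<close> bounds \<open>absv (poly A x)\<close> by
  \<open>absv (fact q) * \<rho> ^ (n - q)\<close>; were all roots of \<open>A\<close> outside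
  \<open>D\<close>, their distances from \<open>x\<close> would exceed \<open>\<rho>\<close> and
  make it larger.\<close>

lemma rooted_degree_prime_power: "\<exists>k. rooted_degree = p ^ k"
proof -
  obtain P x where P: "poly_over E P" "lead_coeff P = 1" "poly P x = 0" "degree P = rooted_degree"
    and x: "x \<in> D" "x \<in> Qp_bar"
    using rooted_degree_attained .
  have "P \<noteq> 0" using P(2) by auto
  obtain rs where rs: "set rs \<subseteq> Qp_bar" "P = (\<Prod>r\<leftarrow>rs. [:- r, 1:])"
    using splits[OF poly_over_mono[OF E_subset P(1)] \<open>P \<noteq> 0\<close>] P(2) by auto
  define n where "n = rooted_degree"
  have len: "length rs = n" using P(4) by (simp add: n_def rs(2) degree_prod_list_linear)
  have "rs \<noteq> []" using P(3) rs(2) by auto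
  have rD: "r \<in> D" if r: "r \<in> set rs" for r
  proof -
    have "poly P r = 0"
      using r unfolding rs(2) poly_prod_list_linear by (auto simp: prod_list_zero_iff)
    moreover have "r \<in> Qp_bar" using r rs(1) by blast
    ultimately have "\<exists>\<sigma>\<in>Gal E. \<sigma> x = r"
      using P(1,3,4) \<open>P \<noteq> 0\<close> x rooted_degree_le by (intro Gal_exists[of P]) auto
    then show ?thesis using Gal_disk[OF D_over_E] x by blast
  qed
  \<comment> \<open>The maximum is attained at a root in \<open>D\<close>, so every point within
    \<open>\<rho>\<close> of \<open>x\<close> lies in \<open>D\<close>.\<close>
  define \<rho> where "\<rho> = Max ((\<lambda>r. absv (x - r)) ` set rs)"
  have "\<rho> \<in> (\<lambda>r. absv (x - r)) ` set rs"
    unfolding \<rho>_def using \<open>rs \<noteq> []\<close> by (intro Max_in) auto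
  then obtain r0 where r0: "r0 \<in> D" "\<rho> = absv (r0 - x)" using rD absv_minus_commute by auto
  have le: "absv (x - r) \<le> \<rho>" if "r \<in> set rs" for r
    unfolding \<rho>_def using that by (intro Max_ge) auto
  have "\<rho> \<ge> 0" using r0(2) by simp
  obtain k m where km: "n = p ^ k * m" "\<not> p dvd n choose p ^ k"
    using prime_power_part_binomial[OF prime_p, of n] \<open>rs \<noteq> []\<close> len by auto
  define q where "q = p ^ k"
  have "n > 0" using \<open>rs \<noteq> []\<close> len by auto
  have "q \<le> n" "q > 0" using km(1) \<open>n > 0\<close> by (auto simp: q_def)
  have "\<not> q < n"
  proof
    assume "q < n"
    define A where "A = (pderiv ^^ q) P"
    have deg: "degree A = n - q" using P(4) by (simp add: A_def degree_higher_pderiv n_def)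
    then have "A \<noteq> 0" using \<open>q < n\<close> by auto
    have lead: "lead_coeff A = fact q * of_nat (n choose q)"
      using pochhammer_Suc_eq_fact_binomial[of "n - q" q, where 'a = 'a] P(2,4) \<open>q \<le> n\<close>
      unfolding deg by (simp add: A_def coeff_higher_pderiv n_def)
    have "poly_over E A"
      unfolding poly_over_def
    proof
      fix i
      have "coeff A i = fact q * of_nat ((i + q) choose q) * coeff P (i + q)"
        using pochhammer_Suc_eq_fact_binomial[of i q, where 'a = 'a] by (simp add: A_def coeff_higher_pderiv)
      moreover have "fact q = (of_nat (fact q) :: 'a)" by simp
      ultimately show "coeff A i \<in> E"
        using P(1) E_closed(6,10) unfolding poly_over_def by metis
    qed
    obtain bs where bs: "set bs \<subseteq> Qp_bar" "A = smult (lead_coeff A) (\<Prod>b\<leftarrow>bs. [:- b, 1:])"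
      using splits[OF poly_over_mono[OF E_subset \<open>poly_over E A\<close>] \<open>A \<noteq> 0\<close>] by blast
    have lbs: "length bs = n - q"
      using arg_cong[OF bs(2), of degree] \<open>A \<noteq> 0\<close> leading_coeff_0_iff[of A] deg by (simp add: degree_prod_list_linear)
    have gt: "\<rho> < absv (x - b)" if b: "b \<in> set bs" for b
    proof (rule ccontr)
      assume "\<not> \<rho> < absv (x - b)"
      then have "b \<in> D" using D_mem[OF x(1) r0(1), of b] r0(2) absv_minus_commute[of x b] by simp
      moreover have "poly A b = 0"
        using b by (subst bs(2)) (auto simp: poly_prod_list_linear prod_list_zero_iff)
      ultimately have "n \<le> n - q"
        using rooted_degree_le[OF \<open>poly_over E A\<close> \<open>A \<noteq> 0\<close>] deg by (simp add: n_def)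
      then show False using \<open>q > 0\<close> \<open>n > 0\<close> by simp
    qed
    \<comment> \<open>The binomial coefficient is a unit by the choice of \<open>q\<close>; the
      factor \<open>fact q\<close> may be small but occurs in both estimates.\<close>
    have "absv (lead_coeff A) = absv (fact q :: 'a)"
      using absv_of_nat_eq_1[OF km(2)] by (simp add: lead absv_mult q_def)
    moreover have "absv (poly A x) = absv (lead_coeff A) * (\<Prod>b\<leftarrow>bs. absv (x - b))"
      by (subst bs(2)) (simp add: absv_mult poly_prod_list_linear absv_prod_list o_def)
    \<comment> \<open>Strictness relies on \<open>q < n\<close>, which makes \<open>bs\<close>
      nonempty.\<close>
    moreover have "\<rho> ^ (n - q) < (\<Prod>b\<leftarrow>bs. absv (x - b))"
      using power_less_prod_list[OF \<open>\<rho> \<ge> 0\<close>, of bs] gt lbs \<open>q < n\<close> by fastforce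
    ultimately have "absv (fact q :: 'a) * \<rho> ^ (n - q) < absv (poly A x)" by simp
    moreover have "absv (poly A x) = absv (fact q :: 'a) * absv (coeff (pcompose P [:x, 1:]) q)"
      by (simp add: A_def poly_higher_pderiv absv_mult)
    moreover have "absv (coeff (pcompose P [:x, 1:]) q) \<le> \<rho> ^ (n - q)"
      using coeff_prod_linear_le[OF \<open>\<rho> \<ge> 0\<close> le, of rs q] \<open>q \<le> n\<close> by (simp add: rs(2) len)
    ultimately show False using mult_left_mono[of _ _ "absv (fact q :: 'a)"] by fastforce
  qed
  then show ?thesis using \<open>q \<le> n\<close> unfolding n_def q_def by (metis le_neq_implies_less)
qed

text \<open>No root \<open>b\<close> of \<open>A\<close> lies in \<open>D\<close>, so
  \<open>x\<close> is closer to \<open>y\<close> than \<open>b\<close> is, and each factor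
  \<open>(x - b) / (y - b)\<close> is congruent to 1.\<close>

lemma poly_ratio_on_D:
  assumes A: "poly_over E A" "A \<noteq> 0" "degree A < rooted_degree" and xy: "x \<in> D" "y \<in> D"
  shows "poly A y \<noteq> 0" "absv (poly A x / poly A y - 1) < 1"
proof -
  have root: "poly A z \<noteq> 0" if "z \<in> D" for z
    using rooted_degree_le[OF A(1,2) that] A(3) by auto
  then show "poly A y \<noteq> 0" using xy(2) .
  obtain bs where bs: "A = smult (lead_coeff A) (\<Prod>b\<leftarrow>bs. [:- b, 1:])"
    using splits[OF poly_over_mono[OF E_subset A(1)] A(2)] by blast
  have notD: "b \<notin> D" if "b \<in> set bs" for b
  proof
    assume "b \<in> D"
    moreover have "poly A b = 0"
      using that by (subst bs) (auto simp: poly_prod_list_linear prod_list_zero_iff)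
    ultimately show False using root by blast
  qed
  have "absv ((\<Prod>b\<leftarrow>bs. (x - b) / (y - b)) - 1) < 1"
    using notD
  proof (induction bs)
    case (Cons b bs)
    have "absv (x - y) < absv (b - y)"
      using D_mem[OF xy(2,1), of b] Cons.prems by (meson list.set_intros(1) not_le)
    moreover from le_less_trans[OF absv_nonneg this] have "y - b \<noteq> 0" by simp
    moreover from this have "(x - b) / (y - b) - 1 = (x - y) / (y - b)" by (simp add: field_simps)
    ultimately have 1: "absv ((x - b) / (y - b) - 1) < 1"
      using absv_minus_commute[of b y] by (simp add: absv_divide)
    then have "absv ((x - b) / (y - b)) \<le> 1"
      using absv_add_le[of "(x - b) / (y - b) - 1" 1] by simp
    then show ?case using cong_mult[OF 1 Cons.IH] Cons.prems by simp
  qed simp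
  moreover have "(\<Prod>b\<leftarrow>bs. (x - b) / (y - b)) = (\<Prod>b\<leftarrow>bs. x - b) / (\<Prod>b\<leftarrow>bs. y - b)"
    by (induction bs) simp_all
  moreover have "poly A x / poly A y = (\<Prod>b\<leftarrow>bs. x - b) / (\<Prod>b\<leftarrow>bs. y - b)"
    using A(2) by (subst (1 2) bs) (simp add: poly_prod_list_linear)
  ultimately show "absv (poly A x / poly A y - 1) < 1" by simp
qed

lemma Gal_poly:
  assumes "\<sigma> \<in> Gal E" "poly_over E A" "x \<in> Qp_bar"
  shows "\<sigma> (poly A x) = poly A (\<sigma> x)"
  using assms(2)
proof (induction A)
  case 0
  then show ?case using Gal_D(4)[OF assms(1) E_closed(1)] by simp
next
  case (pCons a A)
  have "poly A x \<in> Qp_bar" "a \<in> Qp_bar" "x * poly A x \<in> Qp_bar"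
    using pCons.prems poly_over_poly[OF sub_A poly_over_mono[OF E_subset] assms(3)] E_subset
      A_closed(6)[OF assms(3)] by (auto simp: poly_over_pCons)
  then show ?case
    using pCons Gal_D[OF assms(1)] assms(3) by (simp add: poly_over_pCons)
qed

text \<open>The quotient \<open>u\<close> of the two values is a unit. Applying
  \<open>\<sigma>\<close> moves \<open>x\<close> within \<open>D\<close>, which changes both values
  only by factors congruent to 1; so the residue of \<open>u\<close> is Galois invariant and
  represented by some \<open>c\<close> in \<open>E\<close>.\<close>

lemma leading_term_cancellation:
  assumes A: "poly_over E A" "A \<noteq> 0" "degree A < rooted_degree"
    and B: "poly_over E B" "B \<noteq> 0" "degree B < rooted_degree"
    and x: "x \<in> D" "x \<in> Qp_bar" and eq: "absv (poly A x) = absv (poly B x)"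
  shows "\<exists>c\<in>E. absv (poly A x - c * poly B x) < absv (poly A x)"
proof -
  define u where "u = poly A x / poly B x"
  have nz: "poly A x \<noteq> 0" "poly B x \<noteq> 0" using poly_ratio_on_D(1) A B x(1) by blast+
  have in_bar: "poly C x \<in> Qp_bar" if "poly_over E C" for C
    using poly_over_poly[OF sub_A poly_over_mono[OF E_subset that] x(2)] .
  have u: "u \<in> Qp_bar" unfolding u_def using in_bar A(1) B(1) A_closed(8) by blast
  have "absv u = 1" using eq nz by (simp add: u_def absv_divide)
  have "absv (\<sigma> u - u) < 1" if \<sigma>: "\<sigma> \<in> Gal E" for \<sigma>
  proof -
    have \<sigma>x: "\<sigma> x \<in> D" using Gal_disk[OF D_over_E \<sigma> x(2,1)] .
    define s t where "s = poly A (\<sigma> x) / poly A x" and "t = poly B (\<sigma> x) / poly B x"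
    have s: "absv (s - 1) < 1" and t: "absv (t - 1) < 1"
      unfolding s_def t_def using poly_ratio_on_D(2)[OF _ _ _ \<sigma>x x(1)] A B by blast+
    have "absv t = 1" using absv_add_eq[of "t - 1" 1] t by simp
    then have "t \<noteq> 0" by auto
    have "\<sigma> u * \<sigma> (poly B x) = \<sigma> (poly A x)"
      using Gal_D(3)[OF \<sigma> u in_bar[OF B(1)]] nz by (simp add: u_def)
    then have "\<sigma> u * (t * poly B x) = s * poly A x"
      using nz by (simp add: Gal_poly[OF \<sigma> _ x(2)] A B s_def t_def)
    then have "\<sigma> u = u * s / t" using nz \<open>t \<noteq> 0\<close> by (simp add: u_def field_simps)
    then have "\<sigma> u - u = u * (s - t) / t" using \<open>t \<noteq> 0\<close> by (simp add: field_simps)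
    then show ?thesis
      using \<open>absv u = 1\<close> \<open>absv t = 1\<close> cong_trans[OF s cong_sym[OF t]] by (simp add: absv_mult absv_divide)
  qed
  then obtain c where c: "c \<in> E" "absv (u - c) < 1"
    using Galois_fixed_residue[OF u] \<open>absv u = 1\<close> by auto
  have "poly A x - c * poly B x = (u - c) * poly B x" using nz by (simp add: u_def field_simps)
  then have "absv (poly A x - c * poly B x) < absv (poly A x)"
    using c(2) nz eq by (simp add: absv_mult)
  then show ?thesis using c(1) by blast
qed

text \<open>Representatives \<open>bs\<close> of the value classes in \<open>V\<close> span
  \<open>V\<close>: otherwise a best approximation \<open>w\<close> of \<open>v\<close> in their
  span could be improved by cancelling the leading term of \<open>v - w\<close>. As \<open>V\<close>
  contains \<open>rooted_degree\<close> independent powers of \<open>x\<close>, there are at least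
  that many classes.\<close>

lemma rooted_degree_le_ramification_index:
  assumes F: "finite_field_ext E F" and x: "x \<in> F" "x \<in> D"
  shows "rooted_degree \<le> ramification_index E F"
proof -
  have sub_F: "subfield F Cp_ring" and EF: "E \<subseteq> F" and F_bar: "F \<subseteq> Qp_bar"
    and dim_F: "ring.finite_dimension Cp_ring E F"
    using F by (auto simp: finite_field_ext_def)
  have x_bar: "x \<in> Qp_bar" using x(1) F_bar by blast
  define V where "V = {poly A x |A. poly_over E A \<and> (A = 0 \<or> degree A < rooted_degree)}"
  have V_add: "v + c * w \<in> V" if vw: "v \<in> V" "w \<in> V" and c: "c \<in> E" for v w c
  proof -
    obtain A B where AB: "v = poly A x" "poly_over E A" "A = 0 \<or> degree A < rooted_degree"
      "w = poly B x" "poly_over E B" "B = 0 \<or> degree B < rooted_degree"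
      using vw unfolding V_def by blast
    have "poly_over E (A + smult c B)" using poly_over_ops[OF sub_E] AB c by blast
    moreover have "A + smult c B = 0 \<or> degree (A + smult c B) < rooted_degree"
      using AB(3,6) degree_add_less[of A rooted_degree "smult c B"] degree_smult_le[of c B]
      by (metis add.right_neutral add_0 le_less_trans smult_0_right)
    moreover have "v + c * w = poly (A + smult c B) x" using AB by simp
    ultimately show ?thesis unfolding V_def by blast
  qed
  have V_0: "0 \<in> V" unfolding V_def using poly_over_0[OF E_closed(1)] by force
  have V_F: "V \<subseteq> F"
    using poly_over_poly[OF sub_F poly_over_mono[OF EF] x(1)] unfolding V_def by blast
  have cancel: "\<exists>c\<in>E. absv (v - c * w) < absv v"
    if vw: "v \<in> V" "w \<in> V" "v \<noteq> 0" and eq: "absv v = absv w" for v w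
  proof -
    have "w \<noteq> 0" using vw(3) eq by (metis absv_eq_0_iff)
    then obtain A B where AB: "v = poly A x" "poly_over E A" "A \<noteq> 0" "degree A < rooted_degree"
      "w = poly B x" "poly_over E B" "B \<noteq> 0" "degree B < rooted_degree"
      using vw unfolding V_def by force
    then show ?thesis using leading_term_cancellation[OF AB(2-4) AB(6-8) x(2) x_bar] eq by simp
  qed
  note ram = ramification_index_le_degree[OF F]
  have sub_classes: "value_class ` (V - {0}) \<subseteq> value_class ` (F - {0})" using V_F by blast
  then have fin: "finite (value_class ` (V - {0}))" using ram(1) finite_subset by blast
  obtain bs where bs: "set bs \<subseteq> V - {0}" "distinct (map value_class bs)"
    "value_class ` set bs = value_class ` (V - {0})" "length bs = card (value_class ` (V - {0}))"
    using value_class_representatives[OF fin] .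
  define W where "W = ring.Span Cp_ring E bs"
  have ind_bs: "ring.independent Cp_ring E bs" using value_class_independent[of bs] bs(1,2) by blast
  have "closed W" unfolding W_def by (rule closed_Span[OF sub_E closed_E])
  have "ring.Span Cp_ring E cs \<subseteq> V" if "set cs \<subseteq> V" for cs
    using that
  proof (induction cs)
    case (Cons u cs)
    show ?case
    proof
      fix y assume "y \<in> ring.Span Cp_ring E (u # cs)"
      then obtain c v where "c \<in> E" "v \<in> ring.Span Cp_ring E cs" "y = c * u + v"
        unfolding Span_Cp_Cons by blast
      then show "y \<in> V" using V_add[of v u c] Cons by (auto simp: add.commute)
    qed
  qed (simp add: V_0)
  then have W_V: "W \<subseteq> V" using bs(1) unfolding W_def by blast
  \<comment> \<open>Elements of \<open>F\<close> have bounded degree over \<open>Qp\<close>, so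
    their values are discrete away from 0.\<close>
  obtain N where N: "\<And>y. y \<in> F \<Longrightarrow> \<exists>P. poly_over Qp P \<and> P \<noteq> 0 \<and> poly P y = 0 \<and> degree P \<le> N"
    using finite_dimension_bounded_degree[OF subfield_Qp sub_F
        Cp.telescopic_base_dim(1)[OF subfield_Qp sub_E finite_E dim_F]] by blast
  note W_closed = Span_Cp_closed[OF sub_E, where Us = bs, folded W_def]
  have "V \<subseteq> W"
  proof
    fix v assume "v \<in> V"
    show "v \<in> W"
    proof (rule ccontr)
      assume "v \<notin> W"
      obtain \<delta> where \<delta>: "\<delta> > 0" "\<And>c w. c \<in> E \<Longrightarrow> w \<in> W \<Longrightarrow> \<delta> * absv c \<le> absv (c * v + w)"
        using closed_subspace_distance[OF sub_E \<open>closed W\<close> W_closed(4) \<open>v \<notin> W\<close>] by blast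
      have \<delta>_le: "\<delta> \<le> absv (v - w)" if "w \<in> W" for w
        using \<delta>(2)[OF E_closed(2) W_closed(3)[OF W_closed(1) that]] by simp
      have vw_V: "v - w \<in> V" if "w \<in> W" for w
        using V_add[OF \<open>v \<in> V\<close>, of w "- 1"] that W_V E_closed(2,3) by auto
      \<comment> \<open>Distances from \<open>v\<close> to points of \<open>W\<close>, cut off at
        the distance of the point 0. This set is finite, consisting of values of \<open>F\<close>
        bounded away from 0, so a smallest distance exists.\<close>
      define T where "T = {absv (v - w) |w. w \<in> W} \<inter> {\<delta>..absv v}"
      have "T \<subseteq> absv ` F \<inter> {\<delta>..absv v}" unfolding T_def using vw_V V_F by blast
      then have "finite T"
        using finite_values_bounded_degree[OF \<delta>(1) N, where t = "absv v"] finite_subset by blast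
      moreover have "absv (v - 0) \<in> T"
        unfolding T_def using W_closed(1) \<delta>_le[OF W_closed(1)] by fastforce
      ultimately have "Min T \<in> T" by (intro Min_in) auto
      then obtain w where w: "w \<in> W" "absv (v - w) = Min T" "Min T \<le> absv v" unfolding T_def by auto
      define y where "y = v - w"
      have y: "y \<in> V" "y \<noteq> 0" using vw_V[OF w(1)] \<open>v \<notin> W\<close> w(1) by (auto simp: y_def)
      \<comment> \<open>The error \<open>y\<close> shares its class with some \<open>b\<close>,
        hence its absolute value with a multiple \<open>c * b\<close>; \<open>cancel\<close> then
        yields the better approximation \<open>w'\<close>.\<close>
      then obtain b where b: "b \<in> set bs" "value_class y = value_class b" using bs(3) by blast
      then obtain c where c: "c \<in> E" "c \<noteq> 0" "absv y = absv (c * b)"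
        unfolding value_class_eq_iff by blast
      have "b \<in> V" "b \<in> W" using b(1) bs(1) W_closed(5) by auto
      have "c * b \<in> V" using V_add[OF V_0 \<open>b \<in> V\<close> c(1)] by simp
      then obtain d where d: "d \<in> E" "absv (y - d * (c * b)) < absv y"
        using cancel[OF y(1) _ y(2) c(3)] by blast
      define w' where "w' = w + d * (c * b)"
      have "w' \<in> W" unfolding w'_def by (intro W_closed w(1) d(1) c(1) \<open>b \<in> W\<close>)
      have less: "absv (v - w') < Min T" using d(2) w(2) by (simp add: w'_def y_def algebra_simps)
      then have "absv (v - w') \<le> absv v" using w(3) by linarith
      then have "absv (v - w') \<in> T"
        unfolding T_def using \<open>w' \<in> W\<close> \<delta>_le[of w'] by auto
      then show False using less Min_le[OF \<open>finite T\<close>] by fastforce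
    qed
  qed
  have alg_x: "(ring.algebraic Cp_ring over E) x"
    using alg[OF x_bar] algebraic_Cp_iff[OF sub_E] by blast
  define d where "d = Polynomials.degree (ring.Irr Cp_ring E x)"
  have "rooted_degree \<le> d"
    using irr_polynomial(1)[OF sub_E alg_x] rooted_degree_le x(2) unfolding d_def by metis
  have "Cp.independent E (Cp.exp_base x d)"
    unfolding d_def by (rule Cp.exp_base_independent[OF sub_E _ alg_x]) simp
  \<comment> \<open>\<open>exp_base\<close> lists powers in descending order, so dropping the first
    entries keeps the powers below \<open>rooted_degree\<close>.\<close>
  then have "Cp.independent E (drop (d - rooted_degree) (Cp.exp_base x d))"
    by (metis append_take_drop_id Cp.independent_split(1)[OF sub_E])
  then have ind: "Cp.independent E (Cp.exp_base x rooted_degree)"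
    using \<open>rooted_degree \<le> d\<close> by (simp add: Cp.drop_exp_base)
  have pow: "x [^]\<^bsub>Cp_ring\<^esub> (i::nat) = x ^ i" for i by (induction i) auto
  have "x ^ i \<in> V" if "i < rooted_degree" for i
    unfolding V_def using that E_closed(1,2)
    by (intro CollectI exI[of _ "monom 1 i"]) (auto simp: poly_monom poly_over_def degree_monom_eq)
  then have "set (Cp.exp_base x rooted_degree) \<subseteq> Cp.Span E bs"
    using \<open>V \<subseteq> W\<close> unfolding W_def by (auto simp: Cp.exp_base_def pow)
  then have "length (Cp.exp_base x rooted_degree) \<le> length bs"
    by (rule Cp.independent_length_le[OF sub_E ind ind_bs])
  also have "\<dots> \<le> ramification_index E F"
    unfolding bs(4) ram(3) by (rule card_mono[OF ram(1) sub_classes])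
  finally show ?thesis by (simp add: Cp.exp_base_def)
qed

text \<open>Adjoin a root in \<open>D\<close> of a polynomial of least degree. An upper bound on the
  degree is enough here; equality follows from the ramification estimate.\<close>

lemma minimal_simple_extension:
  obtains F where "finite_field_ext E F" "F \<inter> D \<noteq> {}" "ext_degree E F \<le> rooted_degree"
proof -
  obtain P x where P: "poly_over E P" "lead_coeff P = 1" "poly P x = 0" "degree P = rooted_degree"
    and x: "x \<in> D" "x \<in> Qp_bar"
    using rooted_degree_attained .
  have "P \<noteq> 0" using P(2) by auto
  have alg_x: "(ring.algebraic Cp_ring over E) x"
    using P(1,3) \<open>P \<noteq> 0\<close> algebraic_Cp_iff[OF sub_E] by blast
  define F where "F = ring.simple_extension Cp_ring E x"
  have "subfield F Cp_ring"
    using Cp.simple_extension_is_subfield[OF sub_E, of x] alg_x by (simp add: F_def)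
  moreover have "E \<subseteq> F" unfolding F_def by (rule Cp.simple_extension_incl) auto
  moreover have "F \<subseteq> Qp_bar"
    unfolding F_def by (rule Cp.simple_extension_subring_incl[OF subfieldE(1)[OF sub_A] E_subset x(2)])
  moreover have "ring.finite_dimension Cp_ring E F"
    using Cp.finite_dimension_simple_extension[OF sub_E, of x] alg_x by (simp add: F_def)
  ultimately have "finite_field_ext E F" using sub_E by (simp add: finite_field_ext_def)
  moreover have "x \<in> F"
    unfolding F_def by (rule Cp.simple_extension_mem[OF subfieldE(1)[OF sub_E]]) simp
  moreover have "ext_degree E F = Polynomials.degree (ring.Irr Cp_ring E x)"
    using Cp.simple_extension_dim[OF sub_E _ alg_x] by (simp add: F_def over_def)
  then have "ext_degree E F \<le> rooted_degree"
    using irr_polynomial(2)[OF sub_E alg_x P(1) \<open>P \<noteq> 0\<close> P(3)] P(4) by simp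
  ultimately show ?thesis using that x(1) by blast
qed

text \<open>For the extension generated by such a root the chain \<open>rooted_degree \<le>
  ramification_index E F \<le> ext_degree E F \<le> rooted_degree\<close> collapses to equalities,
  and its first inequality holds for every competing extension.\<close>

theorem least_ramification_index:
  assumes e: "e = (LEAST e'. \<exists>F. finite_field_ext E F \<and> ramification_index E F = e' \<and> F \<inter> D \<noteq> {})"
  shows "\<exists>s::nat. e = p ^ s \<and>
    (\<exists>F. finite_field_ext E F \<and> totally_ramified E F \<and> ext_degree E F = p ^ s \<and> F \<inter> D \<noteq> {})"
proof -
  obtain F where F: "finite_field_ext E F" "F \<inter> D \<noteq> {}" "ext_degree E F \<le> rooted_degree"
    using minimal_simple_extension .
  obtain x where x: "x \<in> F" "x \<in> D" using F(2) by blast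
  have le: "rooted_degree \<le> ramification_index E F"
    using rooted_degree_le_ramification_index[OF F(1) x] .
  moreover have "ramification_index E F \<le> ext_degree E F"
    by (rule ramification_index_le_degree(2)[OF F(1)])
  ultimately have eq: "ramification_index E F = rooted_degree" "ext_degree E F = rooted_degree"
    using F(3) by linarith+
  have "e = rooted_degree"
    unfolding e
  proof (rule Least_equality)
    show "\<exists>F. finite_field_ext E F \<and> ramification_index E F = rooted_degree \<and> F \<inter> D \<noteq> {}"
      using F eq(1) by blast
    show "rooted_degree \<le> e'"
      if "\<exists>F. finite_field_ext E F \<and> ramification_index E F = e' \<and> F \<inter> D \<noteq> {}" for e'
      using that rooted_degree_le_ramification_index by blast
  qed
  then show ?thesis
    using rooted_degree_prime_power F(1,2) eq unfolding totally_ramified_def by metis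
qed

end

theorem theorem1p2:
  fixes E D :: "'a::{field_char_0, complete_space} set" and e :: nat
  assumes "padic_complex_field TYPE('a) 2"
    and "finite_field_ext Qp E"
    and "disk D"
    and "defined_over E D"
    and "e = (LEAST e'. \<exists>F. finite_field_ext E F \<and> ramification_index E F = e' \<and> F \<inter> D \<noteq> {})"
  shows "\<exists>s::nat. e = 2 ^ s \<and>
    (\<exists>F. finite_field_ext E F \<and> totally_ramified E F \<and> ext_degree E F = 2 ^ s \<and> F \<inter> D \<noteq> {})"
proof -
  have "padic_disk 2 E D"
    using assms(1-4)
    by (simp add: padic_disk_def padic_disk_axioms_def padic_subfield_def padic_subfield_axioms_def
        finite_field_ext_def)
  from padic_disk.least_ramification_index[OF this assms(5)] show ?thesis .
qed

end
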